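(* Let $\varepsilon\in\{1,-1\}$ and let $\mu(u,v)$ and $\nu(u,v)$ be two smooth functions, defined in a domain $\mathcal{D}\subset\mathbb{R}^2$, satisfying $$\mu\,\nu\neq 0,\qquad \mu^2-\nu^2\neq 0,$$ $$\sqrt{\left|\mu^2-\nu^2\right|}\;\Delta^h\ln\left|\mu^2-\nu^2\right|=-4\varepsilon(\mu^2+\nu^2),$$ $$\sqrt{\left|\mu^2-\nu^2\right|}\;\Delta^h\ln\left|\frac{\mu+\nu}{\mu-\nu}\right|=-4\varepsilon\,\mu\,\nu$$ on $\mathcal{D}$, where $\Delta^h=\frac{\partial^2}{\partial u^2}-\frac{\partial^2}{\partial v^2}$. Let $(u_0,v_0)\in\mathcal{D}$, let $p_0\in\mathbb{E}^4_2$, and let $\{x_0,y_0,(n_1)_0,(n_2)_0\}$ be an orthonormal frame at $p_0$ such that $\langle x_0,x_0\rangle=1$, $\langle y_0,y_0\rangle=-1$, $\langle (n_1)_0,(n_1)_0\rangle=\varepsilon$, $\langle (n_2)_0,(n_2)_0\rangle=-\varepsilon$. Then there exist a subdomain $\mathcal{D}_0\subset\mathcal{D}$ with $(u_0,v_0)\in\mathcal{D}_0$ and a unique minimal Lorentz surface of general type $M^2_1: z=z(u,v)$, $(u,v)\in\mathcal{D}_0$, such that $M^2_1$ passes through $p_0$ (with $z(u_0,v_0)=p_0$), the functions $\mu(u,v)$, $\nu(u,v)$ are the geometric functions of $M^2_1$, $\{x_0,y_0,(n_1)_0,(n_2)_0\}$ is the geometric frame of $M^2_1$ at the point $p_0$,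 and $\varepsilon=1$ (resp. $\varepsilon=-1$) in the case the geometric normal vector field $n_1$ is spacelike (resp. timelike). Furthermore, $(u,v)$ are canonical parameters of the surface.
   Context: $\mathbb{E}^4_2$ is $\mathbb{R}^4$ with the flat metric $g_0=dx_1^2+dx_2^2-dx_3^2-dx_4^2$, with inner product $\langle\cdot,\cdot\rangle$. A vector $w$ is spacelike if $\langle w,w\rangle>0$ or $w=0$, timelike if $\langle w,w\rangle<0$, lightlike if $\langle w,w\rangle=0$ and $w\ne0$. A surface $M^2_1$ in $\mathbb{E}^4_2$ is Lorentz if the induced metric has signature $(1,1)$ (the normal planes then also have signature $(1,1)$). Let $\sigma$ be the second fundamental form; $M^2_1$ is minimal if its mean curvature vector $H=\frac12\operatorname{tr}\sigma$ vanishes identically; for a tangent frame with $\langle x,x\rangle=1$, $\langle x,y\rangle=0$, $\langle y,y\rangle=-1$ this means $\sigma(x,x)=\sigma(y,y)$. The first normal space at $p$ is $\operatorname{span}\{\sigma(X,Y):X,Y\in T_pM^2_1\}$. With respect to such a frame, the Gauss curvature is $$K=\frac{\langle\sigma(x,x),\sigma(y,y)\rangle-\langle\sigma(x,y),\sigma(x,y)\rangle}{\langle x,x\rangle\langle y,y\rangle-\langle x,y\rangle^2},$$ and the normal curvature is $$\varkappa=\frac{\langle R^\perp(x,y)n_1,n_2\rangle}{\langle x,x\rangle\langle y,y\rangle-\langle x,y\rangle^2},$$ where $R^\perp(x,y)n_1=D_xD_yn_1-D_yD_xn_1-D_{[x,y]}n_1$, $D$ is the normal connection and $\{n_1,n_2\}$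 is an orthonormal normal frame (changing this frame changes $\varkappa$ at most by sign). A minimal Lorentz surface is of general type if its first normal space is two-dimensional at each point and $K^2-\varkappa^2>0$ on a dense open subset. A geometric frame field of a minimal Lorentz surface of general type is an orthonormal frame field $\{x,y,n_1,n_2\}$, with $x,y$ tangent and $n_1,n_2$ normal, $\langle x,x\rangle=1$, $\langle y,y\rangle=-1$, $\langle n_1,n_1\rangle=\varepsilon$, $\langle n_2,n_2\rangle=-\varepsilon$ ($\varepsilon=\pm1$), such that $$\sigma(x,x)=\sigma(y,y)=\nu\,n_1,\qquad \sigma(x,y)=\mu\,n_2$$ with functions $\mu,\nu$, $\mu\nu\neq0$. The functions $\mu,\nu$ are called the geometric functions of the surface, and the directions of $x,y$ its canonical directions. Parameters $(u,v)$ of the surface $z=z(u,v)$ are canonical if $z_u=\sqrt{E}\,x$, $z_v=\sqrt{-G}\,y$ for the geometric frame field, where $$E=\langle z_u,z_u\rangle=\frac{1}{\sqrt{|\mu^2-\nu^2|}},\quad F=\langle z_u,z_v\rangle=0,\quad G=\langle z_v,z_v\rangle=-\frac{1}{\sqrt{|\mu^2-\nu^2|}}.$$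
   Formalization: Uniqueness is asserted among surfaces z(u,v) with the listed data for which (u,v) are canonical parameters; without that condition, composing with hyperbolic rotations of (u,v) gives other surfaces with the same data, so literal uniqueness is false. *)

theory Defs
  imports "HOL-Analysis.Analysis"
begin

text \<open>
  Surfaces are given by parametrizations z from an open subset of
  \<^typ>\<open>real \<times> real\<close> (parameters (u,v)) to \<^typ>\<open>real^4\<close>.
  Fields along a surface (tangent, normal, or ambient) are functions of the parameters with
  values in \<^typ>\<open>real^4\<close>.
\<close>

section \<open>Smooth functions and partial derivatives\<close>

primrec Ck_on ::
  "nat \<Rightarrow> ('a::real_normed_vector) set \<Rightarrow> ('a \<Rightarrow> 'b::real_normed_vector) \<Rightarrow> bool" where
  "Ck_on 0 S f \<longleftrightarrow> continuous_on S f"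
| "Ck_on (Suc k) S f \<longleftrightarrow>
     (\<forall>p\<in>S. f differentiable (at p)) \<and>
     (\<forall>h. Ck_on k S (\<lambda>p. frechet_derivative f (at p) h))"

text \<open>Only used on open sets S, since the derivatives are taken at p in the whole space.\<close>

definition smooth_on ::
  "('a::real_normed_vector) set \<Rightarrow> ('a \<Rightarrow> 'b::real_normed_vector) \<Rightarrow> bool" where
  "smooth_on S f \<longleftrightarrow> (\<forall>k. Ck_on k S f)"

definition partial_u :: "(real \<times> real \<Rightarrow> 'b::real_normed_vector) \<Rightarrow> real \<times> real \<Rightarrow> 'b" where
  "partial_u f p = frechet_derivative f (at p) (1, 0)"

definition partial_v :: "(real \<times> real \<Rightarrow> 'b::real_normed_vector) \<Rightarrow> real \<times> real \<Rightarrow> 'b" where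
  "partial_v f p = frechet_derivative f (at p) (0, 1)"

definition hyperbolic_laplacian :: "(real \<times> real \<Rightarrow> real) \<Rightarrow> real \<times> real \<Rightarrow> real" where
  "hyperbolic_laplacian f p = partial_u (partial_u f) p - partial_v (partial_v f) p"

section \<open>The flat space of signature (2,2)\<close>

definition ip :: "real^4 \<Rightarrow> real^4 \<Rightarrow> real" where
  "ip a b = a $ 1 * b $ 1 + a $ 2 * b $ 2 - a $ 3 * b $ 3 - a $ 4 * b $ 4"

definition orthonormal_frame ::
  "real \<Rightarrow> real^4 \<Rightarrow> real^4 \<Rightarrow> real^4 \<Rightarrow> real^4 \<Rightarrow> bool" where
  "orthonormal_frame \<epsilon> x y n1 n2 \<longleftrightarrow>
     ip x x = 1 \<and> ip y y = -1 \<and> ip n1 n1 = \<epsilon> \<and> ip n2 n2 = -\<epsilon> \<and>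
     ip x y = 0 \<and> ip x n1 = 0 \<and> ip x n2 = 0 \<and>
     ip y n1 = 0 \<and> ip y n2 = 0 \<and> ip n1 n2 = 0"

section \<open>Lorentz surfaces\<close>

definition tangent_space :: "(real \<times> real \<Rightarrow> real^4) \<Rightarrow> real \<times> real \<Rightarrow> (real^4) set" where
  "tangent_space z p = range (frechet_derivative z (at p))"

definition normal_space :: "(real \<times> real \<Rightarrow> real^4) \<Rightarrow> real \<times> real \<Rightarrow> (real^4) set" where
  "normal_space z p = {w. \<forall>t\<in>tangent_space z p. ip w t = 0}"

text \<open>
  The existence of a tangent orthonormal basis with squares 1 and -1 says that the induced
  metric has signature (1,1).
\<close>

definition lorentz_surface :: "(real \<times> real \<Rightarrow> real^4) \<Rightarrow> (real \<times> real) set \<Rightarrow> bool" where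
  "lorentz_surface z S \<longleftrightarrow>
     open S \<and> smooth_on S z \<and>
     (\<forall>p\<in>S. inj (frechet_derivative z (at p)) \<and>
        (\<exists>x\<in>tangent_space z p. \<exists>y\<in>tangent_space z p.
           ip x x = 1 \<and> ip x y = 0 \<and> ip y y = -1))"

definition normal_part ::
  "(real \<times> real \<Rightarrow> real^4) \<Rightarrow> real \<times> real \<Rightarrow> real^4 \<Rightarrow> real^4" where
  "normal_part z p w = (THE n. n \<in> normal_space z p \<and> w - n \<in> tangent_space z p)"

text \<open>Coordinates of a tangent vector X with respect to the basis \<open>z\<^sub>u, z\<^sub>v\<close>.\<close>

definition tangent_coords ::
  "(real \<times> real \<Rightarrow> real^4) \<Rightarrow> real \<times> real \<Rightarrow> real^4 \<Rightarrow> real \<times> real" where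
  "tangent_coords z p X = inv (frechet_derivative z (at p)) X"

text \<open>The flat connection: derivative at p of a field w along z in the tangent direction X.\<close>

definition flat_deriv ::
  "(real \<times> real \<Rightarrow> real^4) \<Rightarrow> real \<times> real \<Rightarrow> real^4 \<Rightarrow> (real \<times> real \<Rightarrow> real^4) \<Rightarrow> real^4" where
  "flat_deriv z p X w = frechet_derivative w (at p) (tangent_coords z p X)"

text \<open>
  \<open>\<sigma>(X,Y)\<close> is the normal part of the flat derivative along X of a tangent field
  extending Y.  It does not depend on the extension; we take the one whose coordinates with
  respect to \<open>z\<^sub>u, z\<^sub>v\<close> are constant.
\<close>

definition second_fundamental_form ::
  "(real \<times> real \<Rightarrow> real^4) \<Rightarrow> real \<times> real \<Rightarrow> real^4 \<Rightarrow> real^4 \<Rightarrow> real^4" where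
  "second_fundamental_form z p X Y =
     normal_part z p
       (flat_deriv z p X (\<lambda>q. frechet_derivative z (at q) (tangent_coords z p Y)))"

text \<open>The coefficients of the first fundamental form.\<close>

definition coeff_E :: "(real \<times> real \<Rightarrow> real^4) \<Rightarrow> real \<times> real \<Rightarrow> real" where
  "coeff_E z p = ip (partial_u z p) (partial_u z p)"

definition coeff_F :: "(real \<times> real \<Rightarrow> real^4) \<Rightarrow> real \<times> real \<Rightarrow> real" where
  "coeff_F z p = ip (partial_u z p) (partial_v z p)"

definition coeff_G :: "(real \<times> real \<Rightarrow> real^4) \<Rightarrow> real \<times> real \<Rightarrow> real" where
  "coeff_G z p = ip (partial_v z p) (partial_v z p)"

text \<open>
  Half the trace of \<open>\<sigma>\<close> with respect to the induced metric, that is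
  \<open>\<Sum> g\<^sup>i\<^sup>j \<sigma>(z\<^sub>i, z\<^sub>j) / 2\<close>
  with the inverse of the matrix of E, F, G.  For tangent vectors x, y with squares 1, -1 and
  product 0 it is \<open>(\<sigma>(x,x) - \<sigma>(y,y)) / 2\<close>.
\<close>

definition mean_curvature_vector ::
  "(real \<times> real \<Rightarrow> real^4) \<Rightarrow> real \<times> real \<Rightarrow> real^4" where
  "mean_curvature_vector z p =
     (1/2) *\<^sub>R (1 / (coeff_E z p * coeff_G z p - (coeff_F z p)\<^sup>2)) *\<^sub>R
       (coeff_G z p *\<^sub>R second_fundamental_form z p (partial_u z p) (partial_u z p)
        - (2 * coeff_F z p) *\<^sub>R second_fundamental_form z p (partial_u z p) (partial_v z p)
        + coeff_E z p *\<^sub>R second_fundamental_form z p (partial_v z p) (partial_v z p))"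

definition minimal_lorentz_surface ::
  "(real \<times> real \<Rightarrow> real^4) \<Rightarrow> (real \<times> real) set \<Rightarrow> bool" where
  "minimal_lorentz_surface z S \<longleftrightarrow>
     lorentz_surface z S \<and> (\<forall>p\<in>S. mean_curvature_vector z p = 0)"

definition first_normal_space ::
  "(real \<times> real \<Rightarrow> real^4) \<Rightarrow> real \<times> real \<Rightarrow> (real^4) set" where
  "first_normal_space z p =
     span {second_fundamental_form z p X Y | X Y.
             X \<in> tangent_space z p \<and> Y \<in> tangent_space z p}"

section \<open>Adapted frame fields and curvatures\<close>

definition adapted_frame_on ::
  "(real \<times> real \<Rightarrow> real^4) \<Rightarrow> (real \<times> real) set \<Rightarrow> real \<Rightarrow>
   (real \<times> real \<Rightarrow> real^4) \<Rightarrow> (real \<times> real \<Rightarrow> real^4) \<Rightarrow>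
   (real \<times> real \<Rightarrow> real^4) \<Rightarrow> (real \<times> real \<Rightarrow> real^4) \<Rightarrow> bool" where
  "adapted_frame_on z V \<epsilon> x y n1 n2 \<longleftrightarrow>
     \<epsilon> \<in> {1, -1} \<and>
     smooth_on V x \<and> smooth_on V y \<and> smooth_on V n1 \<and> smooth_on V n2 \<and>
     (\<forall>q\<in>V. x q \<in> tangent_space z q \<and> y q \<in> tangent_space z q \<and>
            n1 q \<in> normal_space z q \<and> n2 q \<in> normal_space z q \<and>
            orthonormal_frame \<epsilon> (x q) (y q) (n1 q) (n2 q))"

definition gauss_curvature ::
  "(real \<times> real \<Rightarrow> real^4) \<Rightarrow> real \<times> real \<Rightarrow> real^4 \<Rightarrow> real^4 \<Rightarrow> real" where
  "gauss_curvature z p x y =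
     (ip (second_fundamental_form z p x x) (second_fundamental_form z p y y)
      - ip (second_fundamental_form z p x y) (second_fundamental_form z p x y))
     / (ip x x * ip y y - (ip x y)\<^sup>2)"

definition normal_connection ::
  "(real \<times> real \<Rightarrow> real^4) \<Rightarrow> (real \<times> real \<Rightarrow> real^4) \<Rightarrow> (real \<times> real \<Rightarrow> real^4) \<Rightarrow>
   real \<times> real \<Rightarrow> real^4" where
  "normal_connection z x n q = normal_part z q (flat_deriv z q (x q) n)"

text \<open>The flat connection has no torsion, so this is the Lie bracket of tangent fields.\<close>

definition lie_bracket ::
  "(real \<times> real \<Rightarrow> real^4) \<Rightarrow> (real \<times> real \<Rightarrow> real^4) \<Rightarrow> (real \<times> real \<Rightarrow> real^4) \<Rightarrow>
   real \<times> real \<Rightarrow> real^4" where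
  "lie_bracket z x y q = flat_deriv z q (x q) y - flat_deriv z q (y q) x"

definition normal_curvature_tensor ::
  "(real \<times> real \<Rightarrow> real^4) \<Rightarrow> (real \<times> real \<Rightarrow> real^4) \<Rightarrow> (real \<times> real \<Rightarrow> real^4) \<Rightarrow>
   (real \<times> real \<Rightarrow> real^4) \<Rightarrow> real \<times> real \<Rightarrow> real^4" where
  "normal_curvature_tensor z x y n q =
     normal_connection z x (normal_connection z y n) q
     - normal_connection z y (normal_connection z x n) q
     - normal_connection z (lie_bracket z x y) n q"

definition normal_curvature ::
  "(real \<times> real \<Rightarrow> real^4) \<Rightarrow> (real \<times> real \<Rightarrow> real^4) \<Rightarrow> (real \<times> real \<Rightarrow> real^4) \<Rightarrow>
   (real \<times> real \<Rightarrow> real^4) \<Rightarrow> (real \<times> real \<Rightarrow> real^4) \<Rightarrow> real \<times> real \<Rightarrow> real" where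
  "normal_curvature z x y n1 n2 p =
     ip (normal_curvature_tensor z x y n1 p) (n2 p)
     / (ip (x p) (x p) * ip (y p) (y p) - (ip (x p) (y p))\<^sup>2)"

section \<open>Minimal Lorentz surfaces of general type\<close>

text \<open>
  The Gauss curvature and the square of the normal curvature do not depend on the adapted
  frame, and such a frame exists near every point of a Lorentz surface; so it does not matter
  that the frame is quantified existentially here.
\<close>

definition minimal_general_type ::
  "(real \<times> real \<Rightarrow> real^4) \<Rightarrow> (real \<times> real) set \<Rightarrow> bool" where
  "minimal_general_type z S \<longleftrightarrow>
     minimal_lorentz_surface z S \<and>
     (\<forall>p\<in>S. dim (first_normal_space z p) = 2) \<and>
     (\<exists>W. open W \<and> W \<subseteq> S \<and> S \<subseteq> closure W \<and>
        (\<forall>p\<in>W. \<exists>V \<epsilon> x y n1 n2. open V \<and> p \<in> V \<and> V \<subseteq> S \<and>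
           adapted_frame_on z V \<epsilon> x y n1 n2 \<and>
           (gauss_curvature z p (x p) (y p))\<^sup>2 - (normal_curvature z x y n1 n2 p)\<^sup>2 > 0))"

definition geometric_frame_field ::
  "(real \<times> real \<Rightarrow> real^4) \<Rightarrow> (real \<times> real) set \<Rightarrow> real \<Rightarrow>
   (real \<times> real \<Rightarrow> real) \<Rightarrow> (real \<times> real \<Rightarrow> real) \<Rightarrow>
   (real \<times> real \<Rightarrow> real^4) \<Rightarrow> (real \<times> real \<Rightarrow> real^4) \<Rightarrow>
   (real \<times> real \<Rightarrow> real^4) \<Rightarrow> (real \<times> real \<Rightarrow> real^4) \<Rightarrow> bool" where
  "geometric_frame_field z S \<epsilon> \<mu> \<nu> x y n1 n2 \<longleftrightarrow>
     adapted_frame_on z S \<epsilon> x y n1 n2 \<and>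
     (\<forall>q\<in>S. second_fundamental_form z q (x q) (x q) = \<nu> q *\<^sub>R n1 q \<and>
            second_fundamental_form z q (y q) (y q) = \<nu> q *\<^sub>R n1 q \<and>
            second_fundamental_form z q (x q) (y q) = \<mu> q *\<^sub>R n2 q \<and>
            \<mu> q * \<nu> q \<noteq> 0)"

definition canonical_parameters ::
  "(real \<times> real \<Rightarrow> real^4) \<Rightarrow> (real \<times> real) set \<Rightarrow>
   (real \<times> real \<Rightarrow> real) \<Rightarrow> (real \<times> real \<Rightarrow> real) \<Rightarrow>
   (real \<times> real \<Rightarrow> real^4) \<Rightarrow> (real \<times> real \<Rightarrow> real^4) \<Rightarrow> bool" where
  "canonical_parameters z S \<mu> \<nu> x y \<longleftrightarrow>
     (\<forall>q\<in>S. partial_u z q = sqrt (coeff_E z q) *\<^sub>R x q \<and>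
            partial_v z q = sqrt (- coeff_G z q) *\<^sub>R y q \<and>
            coeff_E z q = 1 / sqrt \<bar>(\<mu> q)\<^sup>2 - (\<nu> q)\<^sup>2\<bar> \<and>
            coeff_F z q = 0 \<and>
            coeff_G z q = - 1 / sqrt \<bar>(\<mu> q)\<^sup>2 - (\<nu> q)\<^sup>2\<bar>)"

text \<open>
  The surface z on S is minimal of general type, passes through \<open>p0\<close> at the parameters
  \<open>c\<close>, and has a geometric frame field with geometric functions \<open>\<mu>, \<nu>\<close> that equals the given
  frame at \<open>c\<close> and for which the parameters are canonical.  The last condition is part of
  the predicate because uniqueness fails without it: if \<open>\<mu>, \<nu>\<close> depend on u only, then
  z(u, v) and z(u, v/2), on a square centred at \<open>c = (0,0)\<close>, share all the other data.
\<close>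

definition canonical_realization ::
  "real \<Rightarrow> (real \<times> real \<Rightarrow> real) \<Rightarrow> (real \<times> real \<Rightarrow> real) \<Rightarrow> real \<times> real \<Rightarrow>
   real^4 \<Rightarrow> real^4 \<Rightarrow> real^4 \<Rightarrow> real^4 \<Rightarrow> real^4 \<Rightarrow>
   (real \<times> real) set \<Rightarrow> (real \<times> real \<Rightarrow> real^4) \<Rightarrow> bool" where
  "canonical_realization \<epsilon> \<mu> \<nu> c p0 x0 y0 n10 n20 S z \<longleftrightarrow>
     minimal_general_type z S \<and>
     z c = p0 \<and>
     (\<exists>x y n1 n2. geometric_frame_field z S \<epsilon> \<mu> \<nu> x y n1 n2 \<and>
        x c = x0 \<and> y c = y0 \<and> n1 c = n10 \<and> n2 c = n20 \<and>
        canonical_parameters z S \<mu> \<nu> x y)"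

end

theory Submission
  imports Defs
begin

text \<open>
  In the parameters of the statement put \<open>a = |\<mu>\<^sup>2 - \<nu>\<^sup>2| powr (-1/4)\<close>, so that \<open>z\<^sub>u = a x\<close> and
  \<open>z\<^sub>v = a y\<close>.  The second fundamental form together with the Codazzi equations
  determines all derivatives of the geometric frame, so a surface as required is the same thing as
  a solution of a linear total differential equation for \<open>(z, x, y, n1, n2)\<close>, and the two
  differential equations for \<open>\<mu>, \<nu>\<close> (Gauss and Ricci) say that this equation is flat.  A flat
  linear equation has exactly one solution with given initial value on a small ball; it is found
  by solving an ordinary linear equation along each radius.
\<close>

section \<open>Calculus of smooth functions\<close>

text \<open>The sum and difference of \<mu> and \<nu> uncouple the Codazzi equations: with m = a
  \<mu> and n = a \<nu> these say that ln |m + n| has the partial derivatives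
  \<open>b2 - f1\<close>, \<open>b1 - f2\<close> and ln |m - n| has \<open>- b2 - f1\<close>,
  \<open>- b1 - f2\<close>. Since \<open>f1\<close>, \<open>f2\<close> are the derivatives of ln a,
  addition makes a^4 |\<mu>^2 - \<nu>^2| locally constant, and canonical parameters normalise the
  constant to 1; this is the origin of the exponent -1/4. Subtraction shows that the normal
  connection is half the gradient of ln |(\<mu> + \<nu>) / (\<mu> - \<nu>)| with its components
  interchanged. A given surface reveals its normal connection only after division by m and n, which
  is where \<mu> \<nu> \<noteq> 0 enters. The analytic difficulty is that integration along rays
  controls only the radial derivative of the candidate. The radius is so small that the coefficient
  along a ray, run through in unit time, acts with norm at most 1/2; this one bound serves the
  contraction, the uniqueness and the error estimate.\<close>

lemma frechet_derivative_eqI: "(f has_derivative f') (at p) \<Longrightarrow> frechet_derivative f (at p) = f'"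
  by (rule frechet_derivative_at [symmetric])

text \<open>A derivative at a point of an open set depends on nearby values only, so agreement on S
  passes to all derivatives. This permits work with formulas that are valid on S alone.\<close>

lemma Ck_on_cong:
  assumes "open S" and "\<And>p. p \<in> S \<Longrightarrow> f p = g p"
  shows "Ck_on k S f \<longleftrightarrow> Ck_on k S g"
  using assms(2)
proof (induction k arbitrary: f g)
  case 0
  then show ?case by (auto cong: continuous_on_cong)
next
  case (Suc k)
  have *: "Ck_on (Suc k) S g" if fg: "\<And>p. p \<in> S \<Longrightarrow> f p = g p" and f: "Ck_on (Suc k) S f"
    for f g :: "'a \<Rightarrow> 'b"
  proof -
    have d: "(g has_derivative frechet_derivative f (at p)) (at p)" if "p \<in> S" for p
      using f that fg \<open>open S\<close>
      by (intro has_derivative_transform_within_open [of f _ p UNIV S g])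
        (auto simp: frechet_derivative_works)
    have "Ck_on k S (\<lambda>p. frechet_derivative g (at p) h)" for h
      using Suc.IH [of "\<lambda>p. frechet_derivative f (at p) h" "\<lambda>p. frechet_derivative g (at p) h"]
        f frechet_derivative_at [OF d] by auto
    then show ?thesis
      using d by (auto simp: differentiable_def)
  qed
  show ?case
    using *[of f g] *[of g f] Suc.prems by metis
qed

text \<open>Replaces the chosen \<open>frechet_derivative\<close> by an explicit formula that need
  hold only at points of S; the congruence transfers its class back.\<close>

lemma Ck_on_SucI:
  assumes "open S"
    and "\<And>p. p \<in> S \<Longrightarrow> (f has_derivative f' p) (at p)"
    and "\<And>h. Ck_on k S (\<lambda>p. f' p h)"
  shows "Ck_on (Suc k) S f"
proof -
  have "Ck_on k S (\<lambda>p. frechet_derivative f (at p) h)" for h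
    using assms(3) [of h]
      Ck_on_cong [OF \<open>open S\<close>, of "\<lambda>p. frechet_derivative f (at p) h" "\<lambda>p. f' p h" k]
      frechet_derivative_eqI [OF assms(2)]
    by auto
  with assms show ?thesis
    by (auto simp: differentiable_def)
qed

lemma Ck_on_Suc_imp: "Ck_on (Suc k) S f \<Longrightarrow> Ck_on k S f"
proof (induction k arbitrary: f)
  case 0
  then show ?case
    by (auto intro!: continuous_at_imp_continuous_on differentiable_imp_continuous_within)
next
  case (Suc k)
  show ?case
    using Suc.prems Suc.IH unfolding Ck_on.simps(2) [of "Suc k"] Ck_on.simps(2) [of k] by blast
qed

lemma Ck_on_Suc_has_derivative:
  "Ck_on (Suc k) S f \<Longrightarrow> p \<in> S \<Longrightarrow> (f has_derivative frechet_derivative f (at p)) (at p)"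
  by (simp add: frechet_derivative_works)

lemma Ck_on_const: "Ck_on k S (\<lambda>p. c)"
  by (induction k arbitrary: c) auto

lemma Ck_on_bounded_linear:
  assumes "bounded_linear l" and "open S" and "Ck_on k S f"
  shows "Ck_on k S (\<lambda>p. l (f p))"
  using assms(3)
proof (induction k arbitrary: f)
  case 0
  then show ?case
    using bounded_linear.continuous_on [OF assms(1)] by auto
next
  case (Suc k)
  show ?case
  proof (rule Ck_on_SucI [OF \<open>open S\<close>])
    fix p assume "p \<in> S"
    then show "((\<lambda>p. l (f p)) has_derivative (\<lambda>h. l (frechet_derivative f (at p) h))) (at p)"
      using bounded_linear.has_derivative [OF assms(1)] Ck_on_Suc_has_derivative [OF Suc.prems]
      by blast
  next
    show "Ck_on k S (\<lambda>p. l (frechet_derivative f (at p) h))" for h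
      using Suc by simp
  qed
qed

lemma Ck_on_add:
  assumes "open S" and "Ck_on k S f" and "Ck_on k S g"
  shows "Ck_on k S (\<lambda>p. f p + g p)"
  using assms(2,3)
proof (induction k arbitrary: f g)
  case 0
  then show ?case by (auto intro: continuous_intros)
next
  case (Suc k)
  show ?case
  proof (rule Ck_on_SucI [OF \<open>open S\<close>])
    fix p assume "p \<in> S"
    then show "((\<lambda>p. f p + g p) has_derivative
        (\<lambda>h. frechet_derivative f (at p) h + frechet_derivative g (at p) h)) (at p)"
      using Suc.prems by (intro has_derivative_add Ck_on_Suc_has_derivative)
  next
    show "Ck_on k S (\<lambda>p. frechet_derivative f (at p) h + frechet_derivative g (at p) h)" for h
      using Suc by simp
  qed
qed

text \<open>The product rule differentiates one factor at a time, and the other drops to class k by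
  \<open>Ck_on_Suc_imp\<close>. One induction thus covers products of reals, scalar multiples and
  the action of a connection form.\<close>

lemma Ck_on_bounded_bilinear:
  assumes "bounded_bilinear b" and "open S" and "Ck_on k S f" and "Ck_on k S g"
  shows "Ck_on k S (\<lambda>p. b (f p) (g p))"
  using assms(3,4)
proof (induction k arbitrary: f g)
  case 0
  then show ?case
    using bounded_bilinear.continuous_on [OF assms(1)] by auto
next
  case (Suc k)
  show ?case
  proof (rule Ck_on_SucI [OF \<open>open S\<close>])
    fix p assume "p \<in> S"
    then show "((\<lambda>p. b (f p) (g p)) has_derivative
        (\<lambda>h. b (f p) (frechet_derivative g (at p) h) + b (frechet_derivative f (at p) h) (g p)))
        (at p)"
      using Suc.prems by (intro bounded_bilinear.FDERIV [OF assms(1)] Ck_on_Suc_has_derivative)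
  next
    fix h
    show "Ck_on k S (\<lambda>p. b (f p) (frechet_derivative g (at p) h)
        + b (frechet_derivative f (at p) h) (g p))"
      using Suc.prems Suc.IH Ck_on_Suc_imp [OF Suc.prems(1)] Ck_on_Suc_imp [OF Suc.prems(2)]
      by (intro Ck_on_add \<open>open S\<close>) auto
  qed
qed

text \<open>The derivative of 1/f contains 1/f again, and the induction hypothesis supplies this
  factor at class k.\<close>

lemma Ck_on_inverse:
  fixes f :: "'a::real_normed_vector \<Rightarrow> real"
  assumes "open S" and "\<And>p. p \<in> S \<Longrightarrow> f p \<noteq> 0" and "Ck_on k S f"
  shows "Ck_on k S (\<lambda>p. inverse (f p))"
  using assms(3)
proof (induction k)
  case 0
  then show ?case using assms(2) by (auto intro: continuous_intros)
next
  case (Suc k)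
  show ?case
  proof (rule Ck_on_SucI [OF \<open>open S\<close>])
    fix p assume "p \<in> S"
    then show "((\<lambda>p. inverse (f p)) has_derivative
        (\<lambda>h. - (inverse (f p) * frechet_derivative f (at p) h * inverse (f p)))) (at p)"
      using assms(2) Suc.prems
      by (intro Deriv.has_derivative_inverse Ck_on_Suc_has_derivative) auto
  next
    fix h
    note mult = Ck_on_bounded_bilinear [OF bounded_bilinear_mult \<open>open S\<close>]
    have "Ck_on k S (\<lambda>p. inverse (f p))"
      using Suc.IH Ck_on_Suc_imp [OF Suc.prems] by simp
    then have "Ck_on k S (\<lambda>p. inverse (f p) * frechet_derivative f (at p) h * inverse (f p))"
      using Suc.prems by (intro mult) auto
    then show "Ck_on k S (\<lambda>p. - (inverse (f p) * frechet_derivative f (at p) h * inverse (f p)))"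
      by (intro Ck_on_bounded_linear [OF bounded_linear_minus [OF bounded_linear_ident]] \<open>open S\<close>)
  qed
qed

lemma Ck_on_exp:
  fixes f :: "'a::real_normed_vector \<Rightarrow> real"
  assumes "open S" and "Ck_on k S f"
  shows "Ck_on k S (\<lambda>p. exp (f p))"
  using assms(2)
proof (induction k)
  case 0
  then show ?case by (auto intro: continuous_intros)
next
  case (Suc k)
  show ?case
  proof (rule Ck_on_SucI [OF \<open>open S\<close>])
    fix p assume "p \<in> S"
    then show "((\<lambda>p. exp (f p)) has_derivative (\<lambda>h. exp (f p) * frechet_derivative f (at p) h)) (at p)"
      using Suc.prems by (auto intro!: derivative_eq_intros Ck_on_Suc_has_derivative)
  next
    show "Ck_on k S (\<lambda>p. exp (f p) * frechet_derivative f (at p) h)" for h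
      using Suc.IH Suc.prems Ck_on_Suc_imp [OF Suc.prems]
      by (intro Ck_on_bounded_bilinear [OF bounded_bilinear_mult \<open>open S\<close>]) auto
  qed
qed

section \<open>Closure properties of smooth functions\<close>

lemma smooth_on_cong:
  "open S \<Longrightarrow> (\<And>p. p \<in> S \<Longrightarrow> f p = g p) \<Longrightarrow> smooth_on S f \<longleftrightarrow> smooth_on S g"
  unfolding smooth_on_def using Ck_on_cong by blast

lemma smooth_on_const: "smooth_on S (\<lambda>p. c)"
  by (simp add: smooth_on_def Ck_on_const)

lemma smooth_on_bounded_linear:
  "bounded_linear l \<Longrightarrow> open S \<Longrightarrow> smooth_on S f \<Longrightarrow> smooth_on S (\<lambda>p. l (f p))"
  by (simp add: smooth_on_def Ck_on_bounded_linear)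

lemma smooth_on_bounded_bilinear:
  "bounded_bilinear b \<Longrightarrow> open S \<Longrightarrow> smooth_on S f \<Longrightarrow> smooth_on S g \<Longrightarrow>
    smooth_on S (\<lambda>p. b (f p) (g p))"
  by (simp add: smooth_on_def Ck_on_bounded_bilinear)

lemma smooth_on_add:
  "open S \<Longrightarrow> smooth_on S f \<Longrightarrow> smooth_on S g \<Longrightarrow> smooth_on S (\<lambda>p. f p + g p)"
  by (simp add: smooth_on_def Ck_on_add)

lemma smooth_on_minus: "open S \<Longrightarrow> smooth_on S f \<Longrightarrow> smooth_on S (\<lambda>p. - f p)"
  by (rule smooth_on_bounded_linear [OF bounded_linear_minus [OF bounded_linear_ident]])

lemma smooth_on_diff:
  "open S \<Longrightarrow> smooth_on S f \<Longrightarrow> smooth_on S g \<Longrightarrow> smooth_on S (\<lambda>p. f p - g p)"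
  using smooth_on_add [of S f "\<lambda>p. - g p"] smooth_on_minus [of S g] by simp

lemma smooth_on_scaleR:
  "open S \<Longrightarrow> smooth_on S f \<Longrightarrow> smooth_on S g \<Longrightarrow> smooth_on S (\<lambda>p. f p *\<^sub>R g p)"
  by (rule smooth_on_bounded_bilinear [OF bounded_bilinear_scaleR])

lemma smooth_on_mult:
  fixes f g :: "'a::real_normed_vector \<Rightarrow> real"
  shows "open S \<Longrightarrow> smooth_on S f \<Longrightarrow> smooth_on S g \<Longrightarrow> smooth_on S (\<lambda>p. f p * g p)"
  by (rule smooth_on_bounded_bilinear [OF bounded_bilinear_mult])

lemma smooth_on_inverse:
  fixes f :: "'a::real_normed_vector \<Rightarrow> real"
  shows "open S \<Longrightarrow> smooth_on S f \<Longrightarrow> (\<And>p. p \<in> S \<Longrightarrow> f p \<noteq> 0) \<Longrightarrow>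
    smooth_on S (\<lambda>p. inverse (f p))"
  by (simp add: smooth_on_def Ck_on_inverse)

lemma smooth_on_divide:
  fixes f g :: "'a::real_normed_vector \<Rightarrow> real"
  shows "open S \<Longrightarrow> smooth_on S f \<Longrightarrow> smooth_on S g \<Longrightarrow> (\<And>p. p \<in> S \<Longrightarrow> g p \<noteq> 0) \<Longrightarrow>
    smooth_on S (\<lambda>p. f p / g p)"
  by (simp add: divide_inverse smooth_on_mult smooth_on_inverse)

lemma smooth_on_exp:
  fixes f :: "'a::real_normed_vector \<Rightarrow> real"
  shows "open S \<Longrightarrow> smooth_on S f \<Longrightarrow> smooth_on S (\<lambda>p. exp (f p))"
  by (simp add: smooth_on_def Ck_on_exp)

text \<open>A pair is the sum of the images of its components under the two linear embeddings into
  the product.\<close>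

lemma smooth_on_Pair:
  assumes "open S" and "smooth_on S f" and "smooth_on S g"
  shows "smooth_on S (\<lambda>p. (f p, g p))"
proof -
  have "smooth_on S (\<lambda>p. (f p, 0) + (0, g p))"
    using assms by (intro smooth_on_add smooth_on_bounded_linear [of "\<lambda>x. (x, 0)"]
        smooth_on_bounded_linear [of "\<lambda>x. (0, x)"])
      (auto intro!: bounded_linear_Pair bounded_linear_ident bounded_linear_zero)
  then show ?thesis by simp
qed

lemma smooth_on_has_derivative:
  "smooth_on S f \<Longrightarrow> p \<in> S \<Longrightarrow> (f has_derivative frechet_derivative f (at p)) (at p)"
  unfolding smooth_on_def using Ck_on_Suc_has_derivative by blast

lemma smooth_on_frechet_derivative:
  "smooth_on S f \<Longrightarrow> smooth_on S (\<lambda>p. frechet_derivative f (at p) h)"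
  unfolding smooth_on_def by (metis Ck_on.simps(2))

lemma smooth_on_partial:
  assumes "smooth_on S f"
  shows "smooth_on S (partial_u f)" "smooth_on S (partial_v f)"
  using smooth_on_frechet_derivative [OF assms] by (auto simp: partial_u_def [abs_def] partial_v_def [abs_def])

lemma smooth_on_imp_continuous_on: "smooth_on S f \<Longrightarrow> continuous_on S f"
  unfolding smooth_on_def using Ck_on.simps(1) by blast

lemma smooth_on_subset:
  assumes "smooth_on S f" and "T \<subseteq> S"
  shows "smooth_on T f"
proof -
  have "Ck_on k S f \<Longrightarrow> Ck_on k T f" for k
    by (induction k arbitrary: f) (use \<open>T \<subseteq> S\<close> continuous_on_subset in auto)
  with assms(1) show ?thesis by (auto simp: smooth_on_def)
qed

lemma smooth_onI_has_derivative:
  assumes "open S"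
    and "\<And>p. p \<in> S \<Longrightarrow> (f has_derivative f' p) (at p)"
    and "\<And>h. smooth_on S (\<lambda>p. f' p h)"
  shows "smooth_on S f"
  unfolding smooth_on_def
proof
  fix k
  have "Ck_on (Suc k) S f"
    using assms Ck_on_SucI unfolding smooth_on_def by blast
  then show "Ck_on k S f" by (rule Ck_on_Suc_imp)
qed

text \<open>Solutions of a linear total differential equation gain regularity: the right-hand side
  is as smooth as the solution itself.\<close>

lemma smooth_on_bootstrap:
  assumes "bounded_bilinear act" and "open S"
    and "\<And>p. p \<in> S \<Longrightarrow> (f has_derivative (\<lambda>h. act (M h p) (f p))) (at p)"
    and "\<And>h. smooth_on S (M h)"
  shows "smooth_on S f"
proof -
  have "Ck_on k S f" for k
  proof (induction k)
    case 0
    show ?case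
      using assms(3) by (auto intro!: continuous_at_imp_continuous_on has_derivative_continuous)
  next
    case (Suc k)
    have "Ck_on k S (\<lambda>p. act (M h p) (f p))" for h
      using assms(4) Suc unfolding smooth_on_def
      by (intro Ck_on_bounded_bilinear [OF assms(1,2)]) auto
    then show ?case
      using Ck_on_SucI [OF \<open>open S\<close> assms(3), where k = k] by blast
  qed
  then show ?thesis by (simp add: smooth_on_def)
qed

section \<open>Rules for partial derivatives\<close>

lemma frechet_derivative_eq_partials:
  assumes "f differentiable (at p)"
  shows "frechet_derivative f (at p) h = fst h *\<^sub>R partial_u f p + snd h *\<^sub>R partial_v f p"
proof -
  have lin: "linear (frechet_derivative f (at p))"
    using assms by (rule linear_frechet_derivative)
  have "frechet_derivative f (at p) h
      = frechet_derivative f (at p) (fst h *\<^sub>R (1, 0) + snd h *\<^sub>R (0, 1))"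
    by simp
  also have "\<dots> = fst h *\<^sub>R partial_u f p + snd h *\<^sub>R partial_v f p"
    unfolding partial_u_def partial_v_def using lin by (simp only: linear_add linear_scale)
  finally show ?thesis .
qed

lemma smooth_on_has_derivative_partials:
  assumes "smooth_on S f" and "p \<in> S"
  shows "(f has_derivative (\<lambda>h. fst h *\<^sub>R partial_u f p + snd h *\<^sub>R partial_v f p)) (at p)"
proof -
  have "f differentiable (at p)"
    using smooth_on_has_derivative [OF assms] by (auto simp: differentiable_def)
  then have "frechet_derivative f (at p) = (\<lambda>h. fst h *\<^sub>R partial_u f p + snd h *\<^sub>R partial_v f p)"
    using frechet_derivative_eq_partials by blast
  then show ?thesis
    using smooth_on_has_derivative [OF assms] by simp
qed

lemma partial_eqI:
  assumes "(f has_derivative f') (at p)"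
  shows "partial_u f p = f' (1, 0)" "partial_v f p = f' (0, 1)"
  using frechet_derivative_eqI [OF assms] by (simp_all add: partial_u_def partial_v_def)

lemma partial_cong:
  assumes "open S" and "p \<in> S" and "\<And>q. q \<in> S \<Longrightarrow> f q = g q"
  shows "partial_u f p = partial_u g p" "partial_v f p = partial_v g p"
proof -
  have "(f has_derivative f') (at p) \<longleftrightarrow> (g has_derivative f') (at p)" for f'
    using assms by (metis has_derivative_transform_within_open)
  then have "frechet_derivative f (at p) = frechet_derivative g (at p)"
    by (simp add: frechet_derivative_def)
  then show "partial_u f p = partial_u g p" "partial_v f p = partial_v g p"
    by (simp_all add: partial_u_def partial_v_def)
qed

lemma partial_const [simp]:
  "partial_u (\<lambda>q. k) p = 0" "partial_v (\<lambda>q. k) p = 0"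
  using partial_eqI [of "\<lambda>q. k" "\<lambda>h. 0"] by auto

lemma partial_bounded_bilinear:
  assumes "bounded_bilinear b" and "smooth_on S f" and "smooth_on S g" and "p \<in> S"
  shows "partial_u (\<lambda>q. b (f q) (g q)) p = b (partial_u f p) (g p) + b (f p) (partial_u g p)"
    and "partial_v (\<lambda>q. b (f q) (g q)) p = b (partial_v f p) (g p) + b (f p) (partial_v g p)"
  using partial_eqI [OF bounded_bilinear.FDERIV [OF assms(1)
        smooth_on_has_derivative_partials [OF assms(2,4)]
        smooth_on_has_derivative_partials [OF assms(3,4)]]]
  by simp_all

lemma partial_add:
  assumes "smooth_on S f" and "smooth_on S g" and "p \<in> S"
  shows "partial_u (\<lambda>q. f q + g q) p = partial_u f p + partial_u g p"
    and "partial_v (\<lambda>q. f q + g q) p = partial_v f p + partial_v g p"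
  using partial_eqI [OF has_derivative_add [OF
        smooth_on_has_derivative_partials [OF assms(1,3)]
        smooth_on_has_derivative_partials [OF assms(2,3)]]]
  by simp_all

lemma partial_diff:
  assumes "smooth_on S f" and "smooth_on S g" and "p \<in> S"
  shows "partial_u (\<lambda>q. f q - g q) p = partial_u f p - partial_u g p"
    and "partial_v (\<lambda>q. f q - g q) p = partial_v f p - partial_v g p"
  using partial_eqI [OF has_derivative_diff [OF
        smooth_on_has_derivative_partials [OF assms(1,3)]
        smooth_on_has_derivative_partials [OF assms(2,3)]]]
  by simp_all

lemma partial_Pair:
  assumes "smooth_on S f" and "smooth_on S g" and "p \<in> S"
  shows "partial_u (\<lambda>q. (f q, g q)) p = (partial_u f p, partial_u g p)"
    and "partial_v (\<lambda>q. (f q, g q)) p = (partial_v f p, partial_v g p)"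
  using partial_eqI [OF has_derivative_Pair [OF smooth_on_has_derivative_partials [OF assms(1,3)]
        smooth_on_has_derivative_partials [OF assms(2,3)]]]
  by simp_all

lemma partial_bounded_linear:
  assumes "bounded_linear l" and "smooth_on S f" and "p \<in> S"
  shows "partial_u (\<lambda>q. l (f q)) p = l (partial_u f p)"
    and "partial_v (\<lambda>q. l (f q)) p = l (partial_v f p)"
  using partial_eqI [OF bounded_linear.has_derivative [OF assms(1)
        smooth_on_has_derivative_partials [OF assms(2,3)]]]
  by simp_all

text \<open>ln |t| = ln (t^2) / 2 removes the distinction of signs.\<close>

lemma has_derivative_ln_abs:
  fixes f :: "'a::real_normed_vector \<Rightarrow> real"
  assumes "(f has_derivative f') (at p)" and "f p \<noteq> 0"
  shows "((\<lambda>p. ln \<bar>f p\<bar>) has_derivative (\<lambda>h. f' h / f p)) (at p)"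
proof -
  have ln: "ln \<bar>t\<bar> = ln (t\<^sup>2) / 2" for t :: real
    using ln_realpow [of "\<bar>t\<bar>" 2] by (cases "t = 0") simp_all
  have "((\<lambda>p. ln ((f p)\<^sup>2) / 2) has_derivative (\<lambda>h. f' h / f p)) (at p)"
    using assms zero_less_power2 [of "f p"]
    by (auto intro!: derivative_eq_intros simp: power2_eq_square divide_simps)
  then show ?thesis by (simp add: ln)
qed

lemma smooth_on_ln_abs:
  fixes f :: "'a::real_normed_vector \<Rightarrow> real"
  assumes "open S" and "smooth_on S f" and "\<And>p. p \<in> S \<Longrightarrow> f p \<noteq> 0"
  shows "smooth_on S (\<lambda>p. ln \<bar>f p\<bar>)"
  using assms
  by (intro smooth_onI_has_derivative [OF assms(1) has_derivative_ln_abs [OF smooth_on_has_derivative]]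
      smooth_on_divide smooth_on_frechet_derivative)

lemma partial_ln_abs:
  fixes f :: "real \<times> real \<Rightarrow> real"
  assumes "smooth_on S f" and "p \<in> S" and "f p \<noteq> 0"
  shows "partial_u (\<lambda>q. ln \<bar>f q\<bar>) p = partial_u f p / f p"
    and "partial_v (\<lambda>q. ln \<bar>f q\<bar>) p = partial_v f p / f p"
  using partial_eqI [OF has_derivative_ln_abs [OF smooth_on_has_derivative_partials [OF assms(1,2)] assms(3)]]
  by simp_all

lemma partial_exp:
  fixes f :: "real \<times> real \<Rightarrow> real"
  assumes "smooth_on S f" and "p \<in> S"
  shows "partial_u (\<lambda>q. exp (f q)) p = exp (f p) * partial_u f p"
    and "partial_v (\<lambda>q. exp (f q)) p = exp (f p) * partial_v f p"
  using partial_eqI [OF has_derivative_exp [OF smooth_on_has_derivative_partials [OF assms]]]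
  by simp_all

subsection \<open>Symmetry of second derivatives\<close>

text \<open>The second difference over a square of side h is the increment over [0, h] of the
  function taking s to f (p + (s, h)) - f (p + (s, 0)). The mean value inequality turns it into a
  difference of \<open>fu\<close> at two points near p, which differentiability of \<open>fu\<close>
  at p evaluates up to o(h).\<close>

lemma second_difference_bound:
  fixes f :: "real \<times> real \<Rightarrow> 'b::real_normed_vector"
  assumes "open S" and "p \<in> S"
    and f: "\<And>q. q \<in> S \<Longrightarrow> (f has_derivative (\<lambda>h. fst h *\<^sub>R fu q + snd h *\<^sub>R fv q)) (at q)"
    and fu: "(fu has_derivative D) (at p)"
    and "e > 0"
  shows "\<exists>d>0. \<forall>h. 0 < h \<and> h < d \<longrightarrow>
    norm (f (p + (h, h)) - f (p + (h, 0)) - f (p + (0, h)) + f p - h\<^sup>2 *\<^sub>R D (0, 1)) \<le> e * h\<^sup>2"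
proof -
  interpret D: bounded_linear D using fu by (rule has_derivative_bounded_linear)
  obtain r where r: "r > 0" "ball p r \<subseteq> S"
    using \<open>open S\<close> \<open>p \<in> S\<close> open_contains_ball by blast
  obtain d where d: "d > 0" "\<And>q. norm (q - p) < d \<Longrightarrow> norm (fu q - fu p - D (q - p)) \<le> e/4 * norm (q - p)"
    using fu \<open>e > 0\<close> unfolding has_derivative_at_alt by (metis divide_pos_pos zero_less_numeral)
  \<comment> \<open>Points (s, t) with s, t in [0, h] have norm at most 2 h; halving keeps them
    within both radii.\<close>
  define \<delta> where "\<delta> = min d r / 2"
  have "norm (f (p + (h, h)) - f (p + (h, 0)) - f (p + (0, h)) + f p - h\<^sup>2 *\<^sub>R D (0, 1)) \<le> e * h\<^sup>2"
    if h: "0 < h" "h < \<delta>" for h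
  proof -
    have small: "norm (s, t) < min d r" "norm (s, t) \<le> 2 * h" if "s \<in> {0..h}" "t \<in> {0..h}" for s t :: real
    proof -
      have "norm (s, t) \<le> \<bar>s\<bar> + \<bar>t\<bar>"
        using norm_Pair_le [of s t] by simp
      with that h show "norm (s, t) < min d r" "norm (s, t) \<le> 2 * h"
        by (auto simp: \<delta>_def)
    qed
    \<comment> \<open>The subtracted linear term makes \<open>g h - g 0\<close> the whole quantity
      to be bounded.\<close>
    define g where "g s = f (p + (s, h)) - f (p + (s, 0)) - (s * h) *\<^sub>R D (0, 1)" for s
    define g' where "g' s = fu (p + (s, h)) - fu (p + (s, 0)) - h *\<^sub>R D (0, 1)" for s
    have inS: "p + (s, t) \<in> S" if "s \<in> {0..h}" "t \<in> {0..h}" for s t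
    proof -
      have "dist (p + (s, t)) p = norm (s, t)"
        by (simp add: dist_norm)
      with small [OF that] r show ?thesis by (auto simp: dist_commute)
    qed
    have der: "((\<lambda>s. f (p + (s, t))) has_derivative (\<lambda>k. k *\<^sub>R fu (p + (s, t)))) (at s within {0..h})"
      if "s \<in> {0..h}" "t \<in> {0..h}" for s t
    proof -
      have "((\<lambda>s. p + (s, t)) has_derivative (\<lambda>k. (k, 0))) (at s within {0..h})"
        by (auto intro!: derivative_eq_intros)
      from has_derivative_compose [OF this f [OF inS [OF that]]]
      show ?thesis by (simp add: o_def)
    qed
    have "norm (g h - g 0) \<le> (e * h) * norm (h - 0)"
    proof (rule differentiable_bound [of "{0..h}" g "\<lambda>s k. k *\<^sub>R g' s"])
      fix s assume s: "s \<in> {0..h}"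
      show "(g has_derivative (\<lambda>k. k *\<^sub>R g' s)) (at s within {0..h})"
        unfolding g_def g'_def using s h
        by (auto intro!: derivative_eq_intros der simp: algebra_simps)
      \<comment> \<open>Since D (s, h) - D (s, 0) = h D (0, 1), \<open>g' s\<close> is a difference
        of two remainders of \<open>fu\<close> at p.\<close>
      have "g' s = (fu (p + (s, h)) - fu p - D (s, h)) - (fu (p + (s, 0)) - fu p - D (s, 0))"
        using D.diff [of "(s, h)" "(s, 0)"] D.scaleR [of h "(0, 1)"]
        by (simp add: g'_def algebra_simps)
      also have "norm \<dots> \<le> norm (fu (p + (s, h)) - fu p - D (s, h))
          + norm (fu (p + (s, 0)) - fu p - D (s, 0))"
        by (rule norm_triangle_ineq4)
      also have "\<dots> \<le> e/4 * norm (s, h) + e/4 * norm (s, 0::real)"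
        using d(2) [of "p + (s, h)"] d(2) [of "p + (s, 0)"] small [OF s, of h] small [OF s, of 0] h
        by (intro add_mono) auto
      also have "\<dots> \<le> e/4 * (2 * h) + e/4 * (2 * h)"
        using small [OF s, of h] small [OF s, of 0] h \<open>e > 0\<close>
        by (intro add_mono mult_left_mono) auto
      finally have "norm (g' s) \<le> e * h" by simp
      then show "onorm (\<lambda>k. k *\<^sub>R g' s) \<le> e * h"
        by (intro onorm_le) (simp add: mult.commute mult_left_mono)
    qed (use h in auto)
    then show ?thesis
      using h by (simp add: g_def power2_eq_square algebra_simps flip: zero_prod_def)
  qed
  moreover have "\<delta> > 0" using d r by (simp add: \<delta>_def)
  ultimately show ?thesis by blast
qed

text \<open>The second difference is unchanged when the two variables are interchanged. The bound
  for f and for f composed with the swap therefore puts one and the same quantity, divided by h^2,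
  within e/2 of each mixed derivative.\<close>

lemma symmetric_second_partials:
  fixes f :: "real \<times> real \<Rightarrow> 'b::real_normed_vector"
  assumes "open S" and "p \<in> S" and f: "smooth_on S f"
  shows "partial_v (partial_u f) p = partial_u (partial_v f) p"
proof -
  let ?x = "partial_v (partial_u f) p" and ?y = "partial_u (partial_v f) p"
  define S' where "S' = prod.swap -` S"
  have S': "open S'" "prod.swap p \<in> S'"
    using \<open>open S\<close> \<open>p \<in> S\<close> unfolding S'_def
    by (auto intro!: open_vimage continuous_on_swap)
  have swap: "((\<lambda>q. f (prod.swap q)) has_derivative
      (\<lambda>h. fst h *\<^sub>R partial_v f (prod.swap q) + snd h *\<^sub>R partial_u f (prod.swap q))) (at q)"
    if "q \<in> S'" for q
  proof -
    have "(prod.swap has_derivative prod.swap) (at q)" for q :: "real \<times> real"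
      unfolding prod.swap_def [abs_def] by (auto intro!: derivative_eq_intros)
    from has_derivative_compose [OF this smooth_on_has_derivative_partials [OF f]] that
    show ?thesis by (auto simp: S'_def add.commute)
  qed
  have dv: "((\<lambda>q. partial_v f (prod.swap q)) has_derivative
      (\<lambda>h. fst h *\<^sub>R partial_v (partial_v f) p + snd h *\<^sub>R ?y)) (at (prod.swap p))"
  proof -
    have "(prod.swap has_derivative prod.swap) (at q)" for q :: "real \<times> real"
      unfolding prod.swap_def [abs_def] by (auto intro!: derivative_eq_intros)
    from has_derivative_compose [OF this, of "partial_v f" _ "prod.swap p"]
      smooth_on_has_derivative_partials [OF smooth_on_partial(2) [OF f] \<open>p \<in> S\<close>]
    have "((\<lambda>q. partial_v f (prod.swap q)) has_derivative (\<lambda>h. fst (prod.swap h) *\<^sub>R ?y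
        + snd (prod.swap h) *\<^sub>R partial_v (partial_v f) p)) (at (prod.swap p))"
      unfolding swap_swap .
    then show ?thesis by (simp add: add.commute)
  qed
  have "norm (?x - ?y) \<le> e" if "e > 0" for e
  proof -
    obtain d1 where d1: "d1 > 0" "\<And>h. 0 < h \<Longrightarrow> h < d1 \<Longrightarrow>
        norm (f (p + (h, h)) - f (p + (h, 0)) - f (p + (0, h)) + f p - h\<^sup>2 *\<^sub>R ?x) \<le> e/2 * h\<^sup>2"
      using second_difference_bound [OF \<open>open S\<close> \<open>p \<in> S\<close> smooth_on_has_derivative_partials [OF f]
          smooth_on_has_derivative_partials [OF smooth_on_partial(1) [OF f] \<open>p \<in> S\<close>], of "e/2"] \<open>e > 0\<close>
      by auto
    obtain d2 where d2: "d2 > 0" "\<And>h. 0 < h \<Longrightarrow> h < d2 \<Longrightarrow>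
        norm (f (p + (h, h)) - f (p + (0, h)) - f (p + (h, 0)) + f p - h\<^sup>2 *\<^sub>R ?y) \<le> e/2 * h\<^sup>2"
      using second_difference_bound [OF S' swap dv, of "e/2"] \<open>e > 0\<close>
      by (cases p) auto
    define h where "h = min d1 d2 / 2"
    have h: "0 < h" "h < d1" "h < d2" using d1(1) d2(1) by (auto simp: h_def)
    let ?G = "f (p + (h, h)) - f (p + (h, 0)) - f (p + (0, h)) + f p"
    have "norm (h\<^sup>2 *\<^sub>R (?x - ?y)) = norm ((?G - h\<^sup>2 *\<^sub>R ?y) - (?G - h\<^sup>2 *\<^sub>R ?x))"
      by (simp add: algebra_simps)
    also have "\<dots> \<le> norm (?G - h\<^sup>2 *\<^sub>R ?y) + norm (?G - h\<^sup>2 *\<^sub>R ?x)"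
      by (rule norm_triangle_ineq4)
    also have "\<dots> \<le> e * h\<^sup>2"
      using d1(2) [OF h(1,2)] d2(2) [OF h(1,3)] by (simp add: algebra_simps)
    finally show ?thesis using h by simp
  qed
  then have "norm (?x - ?y) \<le> 0"
    by (meson field_le_epsilon add_0 dual_order.trans order_refl linorder_not_le dense)
  then show ?thesis by simp
qed

section \<open>Linear total differential equations\<close>

text \<open>On an interval of length 1, with a coefficient acting with norm at most 1/2, the Picard
  operator halves distances, so its fixed point lives on the whole interval at once.\<close>

lemma linear_ode_exists:
  fixes act :: "'m::real_normed_vector \<Rightarrow> 'f::banach \<Rightarrow> 'f" and M :: "real \<Rightarrow> 'm"
  assumes act: "bounded_bilinear act"
    and cont: "continuous_on {0..1} M"
    and bound: "\<And>t w. t \<in> {0..1} \<Longrightarrow> norm (act (M t) w) \<le> norm w / 2"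
  shows "\<exists>X. X 0 = x0 \<and>
    (\<forall>t\<in>{0..1}. (X has_vector_derivative act (M t) (X t)) (at t within {0..1}))"
proof -
  interpret act: bounded_bilinear act by (rule act)
  \<comment> \<open>Clamping the time to [0, 1] extends functions on the interval to bounded
    continuous functions on the line, which form a complete space.\<close>
  let ?cl = "\<lambda>t::real. max 0 (min 1 t)"
  have contX: "continuous_on {0..1} (\<lambda>s. act (M s) (X s))" if "continuous_on {0..1} X" for X
    using that cont by (rule act.continuous_on [rotated])
  define J where "J X t = integral {0..t} (\<lambda>s. act (M s) (X s))" for X t
  have J_cont: "continuous_on {0..1} (J X)" if "continuous_on {0..1} X" for X
    unfolding J_def
    by (intro indefinite_integral_continuous_1 integrable_continuous_real contX that)
  define T where "T X = Bcontfun (\<lambda>t. x0 + J (apply_bcontfun X) (?cl t))" for X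
  have T: "apply_bcontfun (T X) = (\<lambda>t. x0 + J (apply_bcontfun X) (?cl t))" for X
  proof -
    have c: "continuous_on UNIV (\<lambda>t. J (apply_bcontfun X) (?cl t))"
      by (rule continuous_on_compose2 [OF J_cont]) (auto intro!: continuous_intros)
    have "compact (J (apply_bcontfun X) ` {0..1})"
      by (intro compact_continuous_image J_cont) auto
    then have "bounded (J (apply_bcontfun X) ` {0..1})"
      by (rule compact_imp_bounded)
    then have "bounded ((\<lambda>y. x0 + y) ` J (apply_bcontfun X) ` {0..1})"
      by (rule bounded_translation)
    then have "bounded (range (\<lambda>t. x0 + J (apply_bcontfun X) (?cl t)))"
      by (rule bounded_subset) auto
    with c show ?thesis
      unfolding T_def by (subst Bcontfun_inverse) (auto simp: bcontfun_def intro: continuous_intros)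
  qed
  have "\<exists>!X. T X = X"
  proof (rule banach_fix_type [of "1/2"])
    show "\<forall>X Y. dist (T X) (T Y) \<le> 1/2 * dist X Y"
    proof (intro allI dist_bound)
      fix X Y :: "real \<Rightarrow>\<^sub>C 'f" and t :: real
      let ?X = "apply_bcontfun X" and ?Y = "apply_bcontfun Y"
      have int: "(\<lambda>s. act (M s) (Z s)) integrable_on {0..?cl t}" if "continuous_on {0..1} Z" for Z
        by (intro integrable_continuous_real continuous_on_subset [OF contX [OF that]]) auto
      have "dist (T X t) (T Y t) = norm (J ?X (?cl t) - J ?Y (?cl t))"
        by (simp add: T dist_norm)
      also have "J ?X (?cl t) - J ?Y (?cl t) = integral {0..?cl t} (\<lambda>s. act (M s) (?X s - ?Y s))"
        unfolding J_def act.diff_right by (intro integral_diff [symmetric] int) auto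
      also have "norm \<dots> \<le> (dist X Y / 2) * (?cl t - 0)"
      proof (rule integral_bound)
        show "continuous_on {0..?cl t} (\<lambda>s. act (M s) (?X s - ?Y s))"
          by (rule continuous_on_subset [OF contX]) (auto intro!: continuous_intros)
        fix s assume s: "s \<in> {0..?cl t}"
        have "norm (act (M s) (?X s - ?Y s)) \<le> norm (?X s - ?Y s) / 2"
          using s by (intro bound) auto
        then show "norm (act (M s) (?X s - ?Y s)) \<le> dist X Y / 2"
          using dist_bounded [of X s Y] by (simp add: dist_norm)
      qed auto
      also have "\<dots> \<le> (dist X Y / 2) * 1"
        by (intro mult_left_mono) auto
      finally show "dist (T X t) (T Y t) \<le> 1/2 * dist X Y" by simp
    qed
  qed auto
  then obtain X where X: "T X = X" by blast
  let ?X = "apply_bcontfun X"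
  have eq: "?X t = x0 + J ?X t" if "t \<in> {0..1}" for t
    using T [of X] that unfolding X by (metis atLeastAtMost_iff max_absorb2 min.absorb2)
  have "?X 0 = x0" using eq [of 0] by (simp add: J_def)
  moreover have "(?X has_vector_derivative act (M t) (?X t)) (at t within {0..1})"
    if t: "t \<in> {0..1}" for t
  proof -
    have "(J ?X has_vector_derivative act (M t) (?X t)) (at t within {0..1})"
      unfolding J_def using t by (intro integral_has_vector_derivative contX) auto
    then have "((\<lambda>t. x0 + J ?X t) has_vector_derivative act (M t) (?X t)) (at t within {0..1})"
      using has_vector_derivative_add [OF has_vector_derivative_const [of x0]] by fastforce
    then show ?thesis
      by (rule has_vector_derivative_transform [OF t, rotated]) (rule eq)
  qed
  ultimately show ?thesis by blast
qed

text \<open>Takes the place of Gronwall's inequality: at a time m where the norm of D is largest,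
  the increment since time 0 is at most \<open>norm (D m) / 2 + e\<close>, and half of
  \<open>norm (D m)\<close> is absorbed on the left. The term e allows an inhomogeneous equation; e
  = 0 gives uniqueness.\<close>

lemma norm_le_of_half_growth:
  fixes D :: "real \<Rightarrow> 'f::real_normed_vector"
  assumes der: "\<And>t. t \<in> {0..1} \<Longrightarrow> (D has_vector_derivative D' t) (at t within {0..1})"
    and bound: "\<And>t. t \<in> {0..1} \<Longrightarrow> norm (D' t) \<le> norm (D t) / 2 + e"
    and "t \<in> {0..1}"
  shows "norm (D t) \<le> 2 * (norm (D 0) + e)"
proof -
  have "continuous_on {0..1} D"
    using der by (intro continuous_on_vector_derivative)
  then have "\<exists>m\<in>{0..1}. \<forall>t\<in>{0..1}. norm (D t) \<le> norm (D m)"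
    by (intro continuous_attains_sup continuous_on_norm) auto
  then obtain m where m: "m \<in> {0..1}" "\<And>t. t \<in> {0..1} \<Longrightarrow> norm (D t) \<le> norm (D m)"
    by blast
  have "norm (D m - D 0) \<le> (norm (D m) / 2 + e) * norm (m - 0)"
  proof (rule differentiable_bound [of "{0..1}" D "\<lambda>t k. k *\<^sub>R D' t"])
    fix s :: real assume s: "s \<in> {0..1}"
    show "(D has_derivative (\<lambda>k. k *\<^sub>R D' s)) (at s within {0..1})"
      using der [OF s] by (simp add: has_vector_derivative_def)
    have "norm (D' s) \<le> norm (D m) / 2 + e"
      using bound [OF s] m(2) [OF s] by linarith
    then show "onorm (\<lambda>k. k *\<^sub>R D' s) \<le> norm (D m) / 2 + e"
      by (intro onorm_le) (simp add: mult.commute mult_left_mono)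
  qed (use m in auto)
  also have "\<dots> \<le> (norm (D m) / 2 + e) * 1"
  proof (rule mult_left_mono)
    show "0 \<le> norm (D m) / 2 + e"
      using bound [OF m(1)] norm_ge_zero [of "D' m"] by linarith
  qed (use m in auto)
  finally have "norm (D m) \<le> 2 * (norm (D 0) + e)"
    using norm_triangle_ineq2 [of "D m" "D 0"] by (simp add: field_simps)
  with m(2) [OF \<open>t \<in> {0..1}\<close>] show ?thesis by linarith
qed


text \<open>The point is that d does not depend on q, because the expansion is applied along a whole
  ray at once. It rests on the uniform continuity of the partial derivatives and the mean value
  inequality on segments, which stay in the convex set K.\<close>

lemma uniform_linearization:
  fixes f :: "real \<times> real \<Rightarrow> 'b::real_normed_vector"
  assumes f: "smooth_on U f" and K: "compact K" "convex K" "K \<subseteq> U" and "e > 0"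
  shows "\<exists>d>0. \<forall>q h. q \<in> K \<and> q + h \<in> K \<and> norm h < d \<longrightarrow>
    norm (f (q + h) - f q) \<le> e \<and>
    norm (f (q + h) - f q - (fst h *\<^sub>R partial_u f q + snd h *\<^sub>R partial_v f q)) \<le> e * norm h"
proof -
  have uc: "\<exists>d>0. \<forall>x\<in>K. \<forall>y\<in>K. norm (y - x) < d \<longrightarrow> norm (g y - g x) \<le> e / 2"
    if "smooth_on U g" for g :: "real \<times> real \<Rightarrow> 'b"
  proof -
    have "uniformly_continuous_on K g"
      using smooth_on_imp_continuous_on [OF that] K continuous_on_subset
      by (blast intro: compact_uniformly_continuous)
    then obtain d where "d > 0" "\<forall>x\<in>K. \<forall>y\<in>K. norm (y - x) < d \<longrightarrow> norm (g y - g x) < e / 2"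
      using \<open>e > 0\<close> unfolding uniformly_continuous_on_def dist_norm by (metis half_gt_zero)
    then show ?thesis by (intro exI [of _ d]) (auto intro: less_imp_le)
  qed
  obtain d0 where d0: "d0 > 0" "\<And>x y. x \<in> K \<Longrightarrow> y \<in> K \<Longrightarrow> norm (y - x) < d0 \<Longrightarrow> norm (f y - f x) \<le> e / 2"
    using uc [OF f] by blast
  obtain d1 where d1: "d1 > 0" "\<And>x y. x \<in> K \<Longrightarrow> y \<in> K \<Longrightarrow> norm (y - x) < d1 \<Longrightarrow>
      norm (partial_u f y - partial_u f x) \<le> e / 2"
    using uc [OF smooth_on_partial(1) [OF f]] by blast
  obtain d2 where d2: "d2 > 0" "\<And>x y. x \<in> K \<Longrightarrow> y \<in> K \<Longrightarrow> norm (y - x) < d2 \<Longrightarrow>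
      norm (partial_v f y - partial_v f x) \<le> e / 2"
    using uc [OF smooth_on_partial(2) [OF f]] by blast
  define d where "d = min d0 (min d1 d2)"
  have "norm (f (q + h) - f q - (fst h *\<^sub>R partial_u f q + snd h *\<^sub>R partial_v f q)) \<le> e * norm h"
    if q: "q \<in> K" "q + h \<in> K" "norm h < d" for q h
  proof -
    let ?S = "closed_segment q (q + h)"
    let ?f' = "\<lambda>x k. fst k *\<^sub>R partial_u f x + snd k *\<^sub>R partial_v f x"
    have S: "?S \<subseteq> K" using q K by (simp add: closed_segment_subset)
    have "norm (f (q + h) - f q - ?f' q (q + h - q)) \<le> norm (q + h - q) * e"
    proof (rule differentiable_bound_linearization [where S = ?S and f' = ?f' and ?x0.0 = q])
      show "q + t *\<^sub>R (q + h - q) \<in> ?S" if "t \<in> {0..1}" for t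
        using that by (auto simp: closed_segment_def algebra_simps intro!: exI [of _ t])
      fix x assume x: "x \<in> ?S"
      then have xK: "x \<in> K" using S by blast
      then have "x \<in> U" using K by blast
      then show "(f has_derivative ?f' x) (at x within ?S)"
        by (rule has_derivative_at_withinI [OF smooth_on_has_derivative_partials [OF f]])
      have "norm (x - q) \<le> norm h"
        using x segment_bound1 [of x q "q + h"] by simp
      with q have xq: "norm (x - q) < d" by simp
      show "onorm (?f' x - ?f' q) \<le> e"
      proof (rule onorm_le, unfold fun_diff_def)
        fix k :: "real \<times> real"
        have "?f' x k - ?f' q k = fst k *\<^sub>R (partial_u f x - partial_u f q)
            + snd k *\<^sub>R (partial_v f x - partial_v f q)"
          by (simp add: algebra_simps)
        also have "norm \<dots> \<le> \<bar>fst k\<bar> * norm (partial_u f x - partial_u f q)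
            + \<bar>snd k\<bar> * norm (partial_v f x - partial_v f q)"
          by (metis norm_scaleR norm_triangle_ineq)
        also have "\<dots> \<le> norm k * (e/2) + norm k * (e/2)"
          using d1(2) [OF q(1) xK] d2(2) [OF q(1) xK] xq norm_fst_le [of "fst k" "snd k"]
            norm_snd_le [of "snd k" "fst k"] \<open>e > 0\<close>
          by (intro add_mono mult_mono) (auto simp: d_def)
        finally show "norm (?f' x k - ?f' q k) \<le> e * norm k"
          by (simp add: algebra_simps)
      qed
    qed auto
    then show ?thesis by (simp add: mult.commute)
  qed
  moreover have "norm (f (q + h) - f q) \<le> e" if "q \<in> K" "q + h \<in> K" "norm h < d" for q h
    using d0(2) [of q "q + h"] that \<open>e > 0\<close> by (simp add: d_def)
  moreover have "d > 0" using d0 d1 d2 by (simp add: d_def)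
  ultimately show ?thesis by blast
qed

text \<open>Here \<open>a, b\<close> are the values of the connection form at a point in two directions,
  \<open>x, y\<close> its two mixed derivatives, and \<open>P, Q\<close> the values at a nearby point; the hypothesis
  is flatness.\<close>

lemma flat_remainder:
  assumes "bounded_bilinear act"
    and "act x X + act b (act a X) = act y X + act a (act b X)"
  shows "act (P + Q) Y - act a X - (act (b + t *\<^sub>R x) X + act (t *\<^sub>R b) (act a X))
    = act (P + Q) (Y - X - act (t *\<^sub>R b) X)
      + (act (P - a - t *\<^sub>R y) X + act (Q - b) X + t *\<^sub>R act (P - a + Q) (act b X))"
proof -
  interpret act: bounded_bilinear act by (rule assms(1))
  have x: "act x X = act y X + act a (act b X) - act b (act a X)"
    using assms(2) by (simp add: algebra_simps)
  show ?thesis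
    by (simp add: x act.add_left act.add_right act.diff_left act.diff_right act.scaleR_left
        act.scaleR_right algebra_simps)
qed


lemma line_has_vector_derivative:
  assumes "smooth_on U f" and "c + t *\<^sub>R d \<in> U"
  shows "((\<lambda>t. f (c + t *\<^sub>R d)) has_vector_derivative
    fst d *\<^sub>R partial_u f (c + t *\<^sub>R d) + snd d *\<^sub>R partial_v f (c + t *\<^sub>R d)) (at t within T)"
proof -
  have "((\<lambda>t. c + t *\<^sub>R d) has_derivative (\<lambda>k. k *\<^sub>R d)) (at t within T)"
    by (auto intro!: derivative_eq_intros)
  from has_derivative_compose [OF this smooth_on_has_derivative_partials [OF assms]]
  show ?thesis
    by (simp add: has_vector_derivative_def algebra_simps)
qed

text \<open>The solution is constructed along the segments issuing from \<open>c\<close>.  For a nearby point,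
  the error of the expected first-order expansion satisfies, along the segment, the same linear
  equation up to a remainder which flatness makes negligible.\<close>

theorem flat_total_equation_local:
  fixes act :: "'m::real_normed_vector \<Rightarrow> 'f::banach \<Rightarrow> 'f" and A B :: "real \<times> real \<Rightarrow> 'm"
  assumes act: "bounded_bilinear act"
    and U: "open U" "c \<in> U"
    and A: "smooth_on U A" and B: "smooth_on U B"
    and flat: "\<And>p w. p \<in> U \<Longrightarrow>
      act (partial_v A p) w + act (A p) (act (B p) w)
        = act (partial_u B p) w + act (B p) (act (A p) w)"
  defines "solves \<equiv> \<lambda>S V. \<forall>p\<in>S.
      (V has_derivative (\<lambda>h. act (fst h *\<^sub>R A p + snd h *\<^sub>R B p) (V p))) (at p)"
  shows "\<exists>r>0. ball c r \<subseteq> U \<and>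
    (\<exists>V. V c = V0 \<and> solves (ball c r) V) \<and>
    (\<forall>V W. V c = W c \<and> solves (ball c r) V \<and> solves (ball c r) W \<longrightarrow>
      (\<forall>p\<in>ball c r. V p = W p))"
proof -
  interpret act: bounded_bilinear act by (rule act)
  \<comment> \<open>The connection form and its derivative: \<open>d\<omega> p k h\<close>
    differentiates the value of \<open>\<omega>\<close> on h, at p in the direction k.\<close>
  define \<omega> where "\<omega> p h = fst h *\<^sub>R A p + snd h *\<^sub>R B p" for p and h :: "real \<times> real"
  define d\<omega> where "d\<omega> p k h = fst h *\<^sub>R (fst k *\<^sub>R partial_u A p + snd k *\<^sub>R partial_v A p)
      + snd h *\<^sub>R (fst k *\<^sub>R partial_u B p + snd k *\<^sub>R partial_v B p)"
    for p and h k :: "real \<times> real"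
  have \<omega>_add: "\<omega> p (h + k) = \<omega> p h + \<omega> p k" and \<omega>_scale: "\<omega> p (s *\<^sub>R h) = s *\<^sub>R \<omega> p h" for p h k s
    by (simp_all add: \<omega>_def algebra_simps)
  have d\<omega>_scale: "d\<omega> p (s *\<^sub>R k) h = s *\<^sub>R d\<omega> p k h" for p s k h
    by (simp add: d\<omega>_def algebra_simps)
  \<comment> \<open>The two sides differ by an expression that is bilinear and alternating in h and
    k, so the coordinate directions treated by \<open>flat\<close> suffice.\<close>
  have flat': "act (d\<omega> p k h) w + act (\<omega> p h) (act (\<omega> p k) w)
      = act (d\<omega> p h k) w + act (\<omega> p k) (act (\<omega> p h) w)" if "p \<in> U" for p h k w
  proof -
    have eq: "act (partial_v A p) w = act (partial_u B p) w + act (B p) (act (A p) w)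
        - act (A p) (act (B p) w)"
      using flat [OF that] by (simp add: algebra_simps)
    show ?thesis
      by (simp add: \<omega>_def d\<omega>_def act.add_left act.add_right act.scaleR_left act.scaleR_right eq
          algebra_simps)
  qed
  obtain \<kappa> where \<kappa>: "\<kappa> > 0" "\<And>m w. norm (act m w) \<le> norm m * norm w * \<kappa>"
    using act.pos_bounded by blast
  obtain R where R: "R > 0" "cball c R \<subseteq> U"
    using U open_contains_cball by blast
  have "\<exists>C>0. \<forall>p\<in>cball c R. norm (A p) \<le> C \<and> norm (B p) \<le> C"
  proof -
    have "bounded (A ` cball c R)" "bounded (B ` cball c R)"
      using smooth_on_imp_continuous_on [OF A] smooth_on_imp_continuous_on [OF B] R
      by (auto intro!: compact_imp_bounded compact_continuous_image elim: continuous_on_subset)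
    then obtain a b where "\<forall>p\<in>cball c R. norm (A p) \<le> a" "\<forall>p\<in>cball c R. norm (B p) \<le> b"
      unfolding bounded_iff by blast
    then show ?thesis by (intro exI [of _ "max 1 (max a b)"]) force
  qed
  then obtain C where C: "C > 0" "\<And>p. p \<in> cball c R \<Longrightarrow> norm (A p) \<le> C"
      "\<And>p. p \<in> cball c R \<Longrightarrow> norm (B p) \<le> C" by blast
  have pair_bound: "norm (fst h *\<^sub>R x + snd h *\<^sub>R y) \<le> 2 * e * norm h"
    if "norm x \<le> e" "norm y \<le> e" for h :: "real \<times> real" and x y :: 'm and e
  proof -
    have "norm (fst h *\<^sub>R x + snd h *\<^sub>R y) \<le> \<bar>fst h\<bar> * norm x + \<bar>snd h\<bar> * norm y"
      by (metis norm_scaleR norm_triangle_ineq)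
    also have "\<dots> \<le> norm h * e + norm h * e"
      using that norm_fst_le [of "fst h" "snd h"] norm_snd_le [of "snd h" "fst h"]
      by (intro add_mono mult_mono) auto
    finally show ?thesis by (simp add: algebra_simps)
  qed
  have \<omega>_bound: "norm (\<omega> p h) \<le> 2 * C * norm h" if "p \<in> cball c R" for p h
    unfolding \<omega>_def by (rule pair_bound) (use C that in auto)
  \<comment> \<open>On the ball of this radius \<open>norm (\<omega> q (p - c))\<close> is at most 2
    C r, so the action along a ray has norm at most 2 C r \<kappa> \<le> 1/2.\<close>
  define r where "r = min R (1 / (4 * C * \<kappa>))"
  have r: "r > 0" "r \<le> R" "4 * C * \<kappa> * r \<le> 1"
  proof -
    show "r > 0" "r \<le> R" using R C \<kappa> by (auto simp: r_def)
    have "4 * C * \<kappa> * r \<le> 4 * C * \<kappa> * (1 / (4 * C * \<kappa>))"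
      using C \<kappa> by (intro mult_left_mono) (auto simp: r_def)
    then show "4 * C * \<kappa> * r \<le> 1" using C \<kappa> by simp
  qed
  define K where "K = cball c r"
  have K: "compact K" "convex K" "K \<subseteq> U" "K \<subseteq> cball c R"
    using r R by (auto simp: K_def)
  have seg: "c + t *\<^sub>R (p - c) \<in> K" if "p \<in> ball c r" "t \<in> {0..1}" for p t
  proof -
    have "norm (t *\<^sub>R (p - c)) \<le> 1 * norm (p - c)"
      using that by (simp only: norm_scaleR) (intro mult_right_mono, auto)
    with that show ?thesis by (simp add: K_def dist_norm norm_minus_commute)
  qed
  have half: "norm (act (\<omega> q (p - c)) w) \<le> norm w / 2" if "q \<in> K" "p \<in> ball c r" for p q w
  proof -
    have "norm (p - c) \<le> r" using that by (simp add: dist_norm norm_minus_commute)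
    have "norm (act (\<omega> q (p - c)) w) \<le> norm (\<omega> q (p - c)) * norm w * \<kappa>" by (rule \<kappa>)
    also have "\<dots> \<le> (2 * C * r) * norm w * \<kappa>"
    proof -
      have "norm (\<omega> q (p - c)) \<le> 2 * C * norm (p - c)"
        using \<omega>_bound K that by blast
      also have "\<dots> \<le> 2 * C * r"
        using C \<open>norm (p - c) \<le> r\<close> by (intro mult_left_mono) auto
      finally show ?thesis using \<kappa> by (intro mult_right_mono) auto
    qed
    also have "\<dots> = (4 * C * \<kappa> * r) * (norm w / 2)" by simp
    also have "\<dots> \<le> 1 * (norm w / 2)" using r by (intro mult_right_mono) auto
    finally show ?thesis by simp
  qed
  have \<omega>_line: "((\<lambda>t. \<omega> (c + t *\<^sub>R d) h) has_vector_derivative d\<omega> (c + t *\<^sub>R d) d h) (at t within {0..1})"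
    if "c + t *\<^sub>R d \<in> U" for d h t
    unfolding \<omega>_def d\<omega>_def
    by (intro has_vector_derivative_add bounded_linear.has_vector_derivative [OF bounded_linear_scaleR_right]
        line_has_vector_derivative [OF A that] line_has_vector_derivative [OF B that])
  have ray: "((\<lambda>t. V (c + t *\<^sub>R (p - c))) has_vector_derivative
      act (\<omega> (c + t *\<^sub>R (p - c)) (p - c)) (V (c + t *\<^sub>R (p - c)))) (at t within {0..1})"
    if V: "solves (ball c r) V" and "p \<in> ball c r" "t \<in> {0..1}" for V p t
  proof -
    have "norm (t *\<^sub>R (p - c)) \<le> 1 * norm (p - c)"
      using that by (simp only: norm_scaleR) (intro mult_right_mono, auto)
    with that have "c + t *\<^sub>R (p - c) \<in> ball c r"
      by (simp add: dist_norm norm_minus_commute)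
    with V have *: "(V has_derivative (\<lambda>h. act (\<omega> (c + t *\<^sub>R (p - c)) h) (V (c + t *\<^sub>R (p - c)))))
        (at (c + t *\<^sub>R (p - c)))"
      by (simp add: solves_def \<omega>_def)
    have "((\<lambda>t. c + t *\<^sub>R (p - c)) has_derivative (\<lambda>k. k *\<^sub>R (p - c))) (at t within {0..1})"
      by (auto intro!: derivative_eq_intros)
    from has_derivative_compose [OF this *]
    show ?thesis by (simp add: has_vector_derivative_def \<omega>_scale act.scaleR_left)
  qed
  \<comment> \<open>Along a ray the difference of two solutions obeys the same linear equation and
    starts at 0.\<close>
  have unique: "V p = W p"
    if "V c = W c" "solves (ball c r) V" "solves (ball c r) W" "p \<in> ball c r" for V W p
  proof -
    let ?\<gamma> = "\<lambda>t. c + t *\<^sub>R (p - c)"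
    let ?D = "\<lambda>t. V (?\<gamma> t) - W (?\<gamma> t)"
    have "norm (?D 1) \<le> 2 * (norm (?D 0) + 0)"
    proof (rule norm_le_of_half_growth)
      show "(?D has_vector_derivative act (\<omega> (?\<gamma> t) (p - c)) (?D t)) (at t within {0..1})"
        if "t \<in> {0..1}" for t
        unfolding act.diff_right using that \<open>p \<in> ball c r\<close> \<open>solves (ball c r) V\<close> \<open>solves (ball c r) W\<close>
        by (intro has_vector_derivative_diff ray)
      show "norm (act (\<omega> (?\<gamma> t) (p - c)) (?D t)) \<le> norm (?D t) / 2 + 0" if "t \<in> {0..1}" for t
        using half [OF seg [OF \<open>p \<in> ball c r\<close> that] \<open>p \<in> ball c r\<close>] by simp
    qed auto
    then show ?thesis using \<open>V c = W c\<close> by simp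
  qed
  \<comment> \<open>The ray from c to p is run through in unit time, so the candidate at p is the
    value at time 1.\<close>
  have "\<exists>X. X 0 = V0 \<and> (\<forall>t\<in>{0..1}. (X has_vector_derivative
      act (\<omega> (c + t *\<^sub>R (p - c)) (p - c)) (X t)) (at t within {0..1}))" if p: "p \<in> ball c r" for p
  proof (rule linear_ode_exists [OF act])
    show "continuous_on {0..1} (\<lambda>t. \<omega> (c + t *\<^sub>R (p - c)) (p - c))"
      using seg [OF p] K by (intro continuous_on_vector_derivative [OF \<omega>_line]) blast
  qed (intro half seg p)
  then obtain X where X0: "\<And>p. p \<in> ball c r \<Longrightarrow> X p 0 = V0"
    and X': "\<And>p t. p \<in> ball c r \<Longrightarrow> t \<in> {0..1} \<Longrightarrow> (X p has_vector_derivative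
      act (\<omega> (c + t *\<^sub>R (p - c)) (p - c)) (X p t)) (at t within {0..1})"
    by metis
  have X_bound: "norm (X p t) \<le> 2 * norm V0" if "p \<in> ball c r" "t \<in> {0..1}" for p t
    using norm_le_of_half_growth [OF X' [OF that(1)], of 0 t] half seg that X0 [OF that(1)] by auto
  define V where "V p = X p 1" for p
  have "V c = V0"
  proof -
    have cr: "c \<in> ball c r" using r by simp
    \<comment> \<open>The ray from c to c is constant: its equation has coefficient 0, and
      \<open>X c\<close> stays at \<open>V0\<close>.\<close>
    have "norm (X c 1 - V0) \<le> 2 * (norm (X c 0 - V0) + 0)"
    proof (rule norm_le_of_half_growth)
      show "((\<lambda>t. X c t - V0) has_vector_derivative 0) (at t within {0..1})"
        if "t \<in> {0..1}" for t
      proof -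
        have "act (\<omega> (c + t *\<^sub>R (c - c)) (c - c)) (X c t) = 0"
          by (simp add: \<omega>_def act.zero_left)
        with X' [OF cr that] show ?thesis
          by (simp add: has_vector_derivative_diff_const)
      qed
    qed auto
    then show ?thesis using X0 [OF cr] by (simp add: V_def)
  qed
  moreover have "solves (ball c r) V"
    unfolding solves_def
  proof
    fix p assume p: "p \<in> ball c r"
    let ?\<Delta> = "p - c"
    have lin: "bounded_linear (\<lambda>h. act (\<omega> p h) (V p))"
      unfolding \<omega>_def by (intro bounded_linear_compose [OF act.bounded_linear_left])
        (auto intro!: bounded_linear_intros)
    \<comment> \<open>The factor of \<open>\<eta> * norm h\<close> in the estimate of
      \<open>?R\<close> below: \<open>2 * norm V0\<close> bounds \<open>X p t\<close>, and the three
      summands in the bracket belong to the three terms of \<open>?R\<close>.\<close>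
    define N where "N = 2 * \<kappa> * norm V0 * (2 * r + 2 + (2 * r + 2 * C) * (2 * C * \<kappa>))"
    have "N \<ge> 0" using \<kappa> r C by (simp add: N_def)
    have "\<exists>d>0. \<forall>y. norm (y - p) < d \<longrightarrow>
        norm (V y - V p - act (\<omega> p (y - p)) (V p)) \<le> e * norm (y - p)" if "e > 0" for e
    proof -
      \<comment> \<open>Gives 2 \<eta> N \<le> e, the 2 being the constant of
        \<open>norm_le_of_half_growth\<close>; N + 1 avoids division by zero.\<close>
      define \<eta> where "\<eta> = e / (2 * (N + 1))"
      have \<eta>: "\<eta> > 0" using \<open>e > 0\<close> \<open>N \<ge> 0\<close> by (simp add: \<eta>_def)
      obtain d1 where d1: "d1 > 0" "\<And>q h. q \<in> K \<Longrightarrow> q + h \<in> K \<Longrightarrow> norm h < d1 \<Longrightarrow>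
          norm (A (q + h) - A q) \<le> \<eta> \<and>
          norm (A (q + h) - A q - (fst h *\<^sub>R partial_u A q + snd h *\<^sub>R partial_v A q)) \<le> \<eta> * norm h"
        using uniform_linearization [OF A K(1-3) \<eta>] by blast
      obtain d2 where d2: "d2 > 0" "\<And>q h. q \<in> K \<Longrightarrow> q + h \<in> K \<Longrightarrow> norm h < d2 \<Longrightarrow>
          norm (B (q + h) - B q) \<le> \<eta> \<and>
          norm (B (q + h) - B q - (fst h *\<^sub>R partial_u B q + snd h *\<^sub>R partial_v B q)) \<le> \<eta> * norm h"
        using uniform_linearization [OF B K(1-3) \<eta>] by blast
      obtain d3 where d3: "d3 > 0" "ball p d3 \<subseteq> ball c r"
        using p open_contains_ball [of "ball c r"] open_ball by blast
      \<comment> \<open>The condition \<open>norm h < \<eta>\<close> makes the part of the third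
        remainder term that is quadratic in h small against \<open>norm h\<close>.\<close>
      define d where "d = min (min d1 d2) (min d3 \<eta>)"
      have "norm (V y - V p - act (\<omega> p (y - p)) (V p)) \<le> e * norm (y - p)"
        if y: "norm (y - p) < d" for y
      proof -
        define h where "h = y - p"
        have h: "norm h < d" using y by (simp add: h_def)
        have "y \<in> ball p d3"
          using y by (simp add: d_def dist_norm norm_minus_commute)
        with d3 have yr: "y \<in> ball c r" by blast
        have yc: "y - c = ?\<Delta> + h" by (simp add: h_def)
        let ?q = "\<lambda>t. c + t *\<^sub>R ?\<Delta>" and ?q' = "\<lambda>t. c + t *\<^sub>R (?\<Delta> + h)"
        \<comment> \<open>At time t the rays to y and to p are t h apart, so a solution should
          change by \<open>act (t *\<^sub>R \<omega> (?q t) h) (X p t)\<close> to first order. The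
          error \<open>?D\<close> vanishes at time 0 and is the wanted remainder at time 1.\<close>
        let ?D = "\<lambda>t. X y t - X p t - act (t *\<^sub>R \<omega> (?q t) h) (X p t)"
        let ?R = "\<lambda>t. act (\<omega> (?q' t) ?\<Delta> - \<omega> (?q t) ?\<Delta> - t *\<^sub>R d\<omega> (?q t) h ?\<Delta>) (X p t)
          + act (\<omega> (?q' t) h - \<omega> (?q t) h) (X p t)
          + t *\<^sub>R act (\<omega> (?q' t) ?\<Delta> - \<omega> (?q t) ?\<Delta> + \<omega> (?q' t) h) (act (\<omega> (?q t) h) (X p t))"
        have qK: "?q t \<in> K" "?q' t \<in> K" if "t \<in> {0..1}" for t
          using seg [OF p that] seg [OF yr that] by (simp_all add: yc)
        have R_bound: "norm (?R t) \<le> \<eta> * N * norm h" if t: "t \<in> {0..1}" for t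
        proof -
          have q': "?q' t = ?q t + t *\<^sub>R h" by (simp add: algebra_simps)
          have th: "norm (t *\<^sub>R h) \<le> norm h"
            using t by (simp add: mult_left_le_one_le)
          have \<Delta>: "norm ?\<Delta> \<le> r" using p by (simp add: dist_norm norm_minus_commute)
          have Xb: "norm (X p t) \<le> 2 * norm V0" by (rule X_bound [OF p t])
          have A': "norm (A (?q' t) - A (?q t)) \<le> \<eta>" "norm (B (?q' t) - B (?q t)) \<le> \<eta>"
              "norm (A (?q' t) - A (?q t) - (fst (t *\<^sub>R h) *\<^sub>R partial_u A (?q t) + snd (t *\<^sub>R h) *\<^sub>R partial_v A (?q t))) \<le> \<eta> * norm h"
              "norm (B (?q' t) - B (?q t) - (fst (t *\<^sub>R h) *\<^sub>R partial_u B (?q t) + snd (t *\<^sub>R h) *\<^sub>R partial_v B (?q t))) \<le> \<eta> * norm h"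
            using d1(2) [OF qK(1) [OF t], of "t *\<^sub>R h"] d2(2) [OF qK(1) [OF t], of "t *\<^sub>R h"] qK(2) [OF t]
              th h mult_left_mono [OF th, of \<eta>] \<eta>
            unfolding q' d_def by (force intro: order_trans)+
          have diff: "norm (\<omega> (?q' t) k - \<omega> (?q t) k) \<le> 2 * \<eta> * norm k" for k
            using pair_bound [OF A'(1,2), of k] by (simp add: \<omega>_def algebra_simps)
          have lin: "norm (\<omega> (?q' t) ?\<Delta> - \<omega> (?q t) ?\<Delta> - t *\<^sub>R d\<omega> (?q t) h ?\<Delta>)
              \<le> 2 * (\<eta> * norm h) * norm ?\<Delta>"
            using pair_bound [OF A'(3,4), of ?\<Delta>] by (simp add: \<omega>_def d\<omega>_def algebra_simps)
          have b1: "norm (act (\<omega> (?q' t) ?\<Delta> - \<omega> (?q t) ?\<Delta> - t *\<^sub>R d\<omega> (?q t) h ?\<Delta>) (X p t))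
              \<le> (2 * (\<eta> * norm h) * r) * (2 * norm V0) * \<kappa>"
            using \<kappa>(1) \<eta> r
            by (intro order_trans [OF \<kappa>(2)] mult_right_mono mult_mono Xb
                order_trans [OF lin] mult_left_mono \<Delta>) auto
          have b2: "norm (act (\<omega> (?q' t) h - \<omega> (?q t) h) (X p t))
              \<le> (2 * \<eta> * norm h) * (2 * norm V0) * \<kappa>"
            using \<kappa>(1) \<eta> by (intro order_trans [OF \<kappa>(2)] mult_right_mono mult_mono Xb diff) auto
          have b3a: "norm (\<omega> (?q' t) ?\<Delta> - \<omega> (?q t) ?\<Delta> + \<omega> (?q' t) h) \<le> 2 * \<eta> * r + 2 * C * \<eta>"
          proof (rule norm_triangle_le, rule add_mono)
            show "norm (\<omega> (?q' t) ?\<Delta> - \<omega> (?q t) ?\<Delta>) \<le> 2 * \<eta> * r"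
              using \<eta> by (intro order_trans [OF diff] mult_left_mono \<Delta>) auto
            have "norm h \<le> \<eta>" using h by (simp add: d_def)
            then show "norm (\<omega> (?q' t) h) \<le> 2 * C * \<eta>"
              using K qK [OF t] C by (intro order_trans [OF \<omega>_bound] mult_left_mono) auto
          qed
          have b3b: "norm (act (\<omega> (?q t) h) (X p t)) \<le> (2 * C * norm h) * (2 * norm V0) * \<kappa>"
            using \<kappa>(1) C K qK [OF t]
            by (intro order_trans [OF \<kappa>(2)] mult_right_mono mult_mono Xb \<omega>_bound) auto
          have "norm (act (\<omega> (?q' t) ?\<Delta> - \<omega> (?q t) ?\<Delta> + \<omega> (?q' t) h) (act (\<omega> (?q t) h) (X p t)))
              \<le> (2 * \<eta> * r + 2 * C * \<eta>) * ((2 * C * norm h) * (2 * norm V0) * \<kappa>) * \<kappa>"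
            using \<kappa>(1) C \<eta> r
            by (intro order_trans [OF \<kappa>(2)] mult_right_mono mult_mono b3a b3b) auto
          then have b3: "norm (t *\<^sub>R act (\<omega> (?q' t) ?\<Delta> - \<omega> (?q t) ?\<Delta> + \<omega> (?q' t) h) (act (\<omega> (?q t) h) (X p t)))
              \<le> (2 * \<eta> * r + 2 * C * \<eta>) * ((2 * C * norm h) * (2 * norm V0) * \<kappa>) * \<kappa>"
            using t mult_left_le_one_le [OF norm_ge_zero, of t] by (auto intro: order_trans)
          have "norm (?R t) \<le> (2 * (\<eta> * norm h) * r) * (2 * norm V0) * \<kappa>
              + (2 * \<eta> * norm h) * (2 * norm V0) * \<kappa>
              + (2 * \<eta> * r + 2 * C * \<eta>) * ((2 * C * norm h) * (2 * norm V0) * \<kappa>) * \<kappa>"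
            by (intro norm_triangle_le add_mono b1 b2 b3)
          also have "\<dots> = \<eta> * N * norm h"
            by (simp add: N_def algebra_simps)
          finally show ?thesis .
        qed
        have "norm (?D 1) \<le> 2 * (norm (?D 0) + \<eta> * N * norm h)"
        proof (rule norm_le_of_half_growth)
          fix t :: real assume t: "t \<in> {0..1}"
          have qU: "?q t \<in> U" using qK [OF t] K by blast
          show "(?D has_vector_derivative act (\<omega> (?q' t) (?\<Delta> + h)) (?D t) + ?R t) (at t within {0..1})"
          proof (rule has_vector_derivative_eq_rhs)
            have s: "((\<lambda>t. t *\<^sub>R \<omega> (?q t) h) has_vector_derivative
                t *\<^sub>R d\<omega> (?q t) ?\<Delta> h + 1 *\<^sub>R \<omega> (?q t) h) (at t within {0..1})"
              by (intro has_vector_derivative_scaleR \<omega>_line qU DERIV_ident)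
            show "(?D has_vector_derivative
                act (\<omega> (?q' t) (?\<Delta> + h)) (X y t) - act (\<omega> (?q t) ?\<Delta>) (X p t)
                - (act (t *\<^sub>R \<omega> (?q t) h) (act (\<omega> (?q t) ?\<Delta>) (X p t))
                  + act (t *\<^sub>R d\<omega> (?q t) ?\<Delta> h + 1 *\<^sub>R \<omega> (?q t) h) (X p t))) (at t within {0..1})"
              using X' [OF yr t] X' [OF p t]
              by (intro has_vector_derivative_diff act.has_vector_derivative s) (auto simp: yc)
            \<comment> \<open>Flatness trades \<open>d\<omega> (?q t) ?\<Delta> h\<close>, which
              arises from differentiating along the ray, for
              \<open>d\<omega> (?q t) h ?\<Delta>\<close>, which is the first-order change of
              \<open>\<omega> (?q' t) ?\<Delta>\<close> and so cancels up to a small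
              remainder.\<close>
            show "act (\<omega> (?q' t) (?\<Delta> + h)) (X y t) - act (\<omega> (?q t) ?\<Delta>) (X p t)
                - (act (t *\<^sub>R \<omega> (?q t) h) (act (\<omega> (?q t) ?\<Delta>) (X p t))
                  + act (t *\<^sub>R d\<omega> (?q t) ?\<Delta> h + 1 *\<^sub>R \<omega> (?q t) h) (X p t))
              = act (\<omega> (?q' t) (?\<Delta> + h)) (?D t) + ?R t"
              using flat_remainder [OF act flat' [OF qU, of ?\<Delta> h "X p t"],
                  of "\<omega> (?q' t) ?\<Delta>" "\<omega> (?q' t) h" "X y t" t]
              by (simp add: \<omega>_add add.commute)
          qed
          show "norm (act (\<omega> (?q' t) (?\<Delta> + h)) (?D t) + ?R t) \<le> norm (?D t) / 2 + \<eta> * N * norm h"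
            using half [OF qK(2) [OF t] yr, of "?D t"] R_bound [OF t]
            unfolding yc by (rule norm_triangle_mono)
        qed auto
        also have "norm (?D 0) = 0" using X0 [OF yr] X0 [OF p] by (simp add: act.zero_left)
        also have "2 * (0 + \<eta> * N * norm h) \<le> e * norm h"
        proof -
          have "2 * \<eta> * N \<le> e"
            using \<open>e > 0\<close> \<open>N \<ge> 0\<close> by (simp add: \<eta>_def divide_simps)
          from mult_right_mono [OF this norm_ge_zero [of h]] show ?thesis by simp
        qed
        finally show ?thesis by (simp add: V_def h_def)
      qed
      moreover have "d > 0" using d1 d2 d3 \<eta> by (simp add: d_def)
      ultimately show ?thesis by blast
    qed
    with lin show "(V has_derivative (\<lambda>h. act (fst h *\<^sub>R A p + snd h *\<^sub>R B p) (V p))) (at p)"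
      unfolding \<omega>_def has_derivative_at_alt by blast
  qed
  moreover have "ball c r \<subseteq> U" using r R by auto
  ultimately show ?thesis using r(1) unique by blast
qed

section \<open>Orthonormal frames\<close>

lemma bounded_bilinear_ip: "bounded_bilinear ip"
proof -
  have "bilinear ip"
    by (auto simp: bilinear_def ip_def algebra_simps intro!: linearI)
  then show ?thesis by (simp add: bilinear_conv_bounded_bilinear)
qed

interpretation ip: bounded_bilinear ip
  by (rule bounded_bilinear_ip)

lemmas ip_linear = ip.add_left ip.add_right ip.diff_left ip.diff_right ip.minus_left ip.minus_right
  ip.scaleR_left ip.scaleR_right

lemma ip_commute: "ip v w = ip w v"
  by (simp add: ip_def mult.commute)

text \<open>Rows and columns of the frame matrix: a one-sided inverse of a square matrix is
  two-sided.\<close>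

lemma orthonormal_frame_iff_columns:
  assumes "\<epsilon> \<in> {1, -1}"
  shows "orthonormal_frame \<epsilon> x y n1 n2 \<longleftrightarrow>
    (\<forall>i k. x $ i * x $ k - y $ i * y $ k + \<epsilon> * (n1 $ i * n1 $ k) - \<epsilon> * (n2 $ i * n2 $ k)
      = ip (axis i 1) (axis k 1))"
proof -
  have ee: "\<epsilon> * \<epsilon> = 1" using assms by auto
  define F where "F j = (if j = 1 then x else if j = 2 then y else if j = 3 then n1 else n2)"
    for j :: 4
  define s where "s j = (if j = 1 then 1 else if j = 2 then -1 else if j = 3 then \<epsilon> else -\<epsilon>)"
    for j :: 4
  define \<eta> :: "4 \<Rightarrow> real" where "\<eta> i = (if i = 1 \<or> i = 2 then 1 else -1)" for i
  define M where "M = (\<chi> j i. F j $ i)"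
  \<comment> \<open>The transpose of \<open>M\<close> with the ambient signs on one side and the
    signs of the frame on the other: \<open>M ** N = mat 1\<close> is orthonormality,
    \<open>N ** M = mat 1\<close> the column relations.\<close>
  define N where "N = (\<chi> i j. \<eta> i * F j $ i * s j)"
  have F: "F 1 = x" "F 2 = y" "F 3 = n1" "F 4 = n2"
    and s: "s 1 = 1" "s 2 = -1" "s 3 = \<epsilon>" "s 4 = -\<epsilon>"
    and \<eta>: "\<eta> 1 = 1" "\<eta> 2 = 1" "\<eta> 3 = -1" "\<eta> 4 = -1"
    by (simp_all add: F_def s_def \<eta>_def)
  have ss: "s j * s j = 1" and \<eta>\<eta>: "\<eta> i * \<eta> i = 1" for i j
    using ee by (auto simp: s_def \<eta>_def)
  have axis: "ip (axis i 1) (axis k 1) = (if i = k then \<eta> i else 0)" for i k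
    using exhaust_4 [of i] exhaust_4 [of k] by (auto simp: ip_def axis_def \<eta>)
  have MN: "(M ** N) $ j $ l = ip (F j) (F l) * s l" for j l
    by (simp add: M_def N_def matrix_matrix_mult_def sum_4 \<eta> ip_def algebra_simps)
  have NM: "(N ** M) $ i $ k = \<eta> i * (x $ i * x $ k - y $ i * y $ k + \<epsilon> * (n1 $ i * n1 $ k)
      - \<epsilon> * (n2 $ i * n2 $ k))" for i k
    by (simp add: M_def N_def matrix_matrix_mult_def sum_4 F s algebra_simps)
  have "orthonormal_frame \<epsilon> x y n1 n2 \<longleftrightarrow> (\<forall>j l. ip (F j) (F l) = (if j = l then s l else 0))"
    unfolding orthonormal_frame_def forall_4 by (auto simp: F s ip_commute)
  also have "\<dots> \<longleftrightarrow> (\<forall>j l. ip (F j) (F l) * s l = (if j = l then 1 else 0))"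
  proof -
    have "a = (if j = l then s l else 0) \<longleftrightarrow> a * s l = (if j = l then 1 else 0)" for a and j l :: 4
      using ss [of l] by (auto simp: algebra_simps) (metis mult.assoc mult.right_neutral)
    then show ?thesis by blast
  qed
  also have "\<dots> \<longleftrightarrow> M ** N = mat 1"
    by (simp add: vec_eq_iff MN mat_def)
  also have "\<dots> \<longleftrightarrow> N ** M = mat 1"
    by (rule matrix_left_right_inverse)
  also have "\<dots> \<longleftrightarrow> (\<forall>i k. \<eta> i * (x $ i * x $ k - y $ i * y $ k + \<epsilon> * (n1 $ i * n1 $ k)
      - \<epsilon> * (n2 $ i * n2 $ k)) = (if i = k then 1 else 0))"
    by (simp add: vec_eq_iff NM mat_def)
  also have "\<dots> \<longleftrightarrow> (\<forall>i k. x $ i * x $ k - y $ i * y $ k + \<epsilon> * (n1 $ i * n1 $ k)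
      - \<epsilon> * (n2 $ i * n2 $ k) = (if i = k then \<eta> i else 0))"
  proof -
    have "\<eta> i * a = (if i = k then 1 else 0) \<longleftrightarrow> a = (if i = k then \<eta> i else 0)" for a i and k :: 4
      by (auto simp: \<eta>_def)
    then show ?thesis by blast
  qed
  finally show ?thesis by (simp add: axis)
qed

text \<open>The column relations are the completeness relation of the frame; contracting them with
  the components of w under the ambient signs reproduces w.\<close>

lemma orthonormal_frame_expansion:
  assumes "\<epsilon> \<in> {1, -1}" and "orthonormal_frame \<epsilon> x y n1 n2"
  shows "w = ip w x *\<^sub>R x - ip w y *\<^sub>R y + (\<epsilon> * ip w n1) *\<^sub>R n1 - (\<epsilon> * ip w n2) *\<^sub>R n2"
proof (rule vec_eq_iff [THEN iffD2], rule allI)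
  fix k
  define c where "c i = x $ i * x $ k - y $ i * y $ k + \<epsilon> * (n1 $ i * n1 $ k) - \<epsilon> * (n2 $ i * n2 $ k)"
    for i
  have c: "c i = ip (axis i 1) (axis k 1)" for i
    using assms orthonormal_frame_iff_columns by (auto simp: c_def)
  have "(ip w x *\<^sub>R x - ip w y *\<^sub>R y + (\<epsilon> * ip w n1) *\<^sub>R n1 - (\<epsilon> * ip w n2) *\<^sub>R n2) $ k
      = w $ 1 * c 1 + w $ 2 * c 2 - w $ 3 * c 3 - w $ 4 * c 4"
    by (simp add: c_def ip_def algebra_simps)
  also have "\<dots> = w $ k"
    using exhaust_4 [of k] by (auto simp: c ip_def axis_def)
  finally show "w $ k = (ip w x *\<^sub>R x - ip w y *\<^sub>R y + (\<epsilon> * ip w n1) *\<^sub>R n1 - (\<epsilon> * ip w n2) *\<^sub>R n2) $ k" ..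
qed

section \<open>Surfaces in conformal parameters\<close>

text \<open>The induced metric is a^2 (du^2 - dv^2); one factor serves both directions because
  canonical parameters satisfy E = - G.\<close>

locale conformal_frame =
  fixes \<epsilon> :: real and S :: "(real \<times> real) set" and a :: "real \<times> real \<Rightarrow> real"
    and z x y n1 n2 :: "real \<times> real \<Rightarrow> real^4"
  assumes \<epsilon>: "\<epsilon> \<in> {1, -1}" and S: "open S"
    and smooth: "smooth_on S a" "smooth_on S z" "smooth_on S x" "smooth_on S y"
      "smooth_on S n1" "smooth_on S n2"
    and a_pos: "\<And>q. q \<in> S \<Longrightarrow> a q > 0"
    and frame: "\<And>q. q \<in> S \<Longrightarrow> orthonormal_frame \<epsilon> (x q) (y q) (n1 q) (n2 q)"
    and zu: "\<And>q. q \<in> S \<Longrightarrow> partial_u z q = a q *\<^sub>R x q"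
    and zv: "\<And>q. q \<in> S \<Longrightarrow> partial_v z q = a q *\<^sub>R y q"
begin

lemma \<epsilon>\<epsilon>: "\<epsilon> * \<epsilon> = 1" "\<epsilon> * (\<epsilon> * t) = t"
  using \<epsilon> by auto

lemma frame_ip:
  assumes "q \<in> S"
  shows "ip (x q) (x q) = 1" "ip (y q) (y q) = -1" "ip (n1 q) (n1 q) = \<epsilon>" "ip (n2 q) (n2 q) = - \<epsilon>"
    "ip (x q) (y q) = 0" "ip (x q) (n1 q) = 0" "ip (x q) (n2 q) = 0"
    "ip (y q) (n1 q) = 0" "ip (y q) (n2 q) = 0" "ip (n1 q) (n2 q) = 0"
    "ip (y q) (x q) = 0" "ip (n1 q) (x q) = 0" "ip (n2 q) (x q) = 0"
    "ip (n1 q) (y q) = 0" "ip (n2 q) (y q) = 0" "ip (n2 q) (n1 q) = 0"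
  using frame [OF assms] by (simp_all add: orthonormal_frame_def ip_commute)

lemma frechet_z:
  assumes "q \<in> S"
  shows "frechet_derivative z (at q) h = (fst h * a q) *\<^sub>R x q + (snd h * a q) *\<^sub>R y q"
proof -
  have "z differentiable (at q)"
    using smooth_on_has_derivative [OF smooth(2) assms] by (auto simp: differentiable_def)
  then show ?thesis
    by (simp add: frechet_derivative_eq_partials zu zv assms)
qed

lemma tangent_iff:
  assumes "q \<in> S"
  shows "w \<in> tangent_space z q \<longleftrightarrow> (\<exists>\<alpha> \<beta>. w = \<alpha> *\<^sub>R x q + \<beta> *\<^sub>R y q)"
proof
  assume "w \<in> tangent_space z q"
  then show "\<exists>\<alpha> \<beta>. w = \<alpha> *\<^sub>R x q + \<beta> *\<^sub>R y q"
    by (auto simp: tangent_space_def frechet_z [OF assms])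
next
  assume "\<exists>\<alpha> \<beta>. w = \<alpha> *\<^sub>R x q + \<beta> *\<^sub>R y q"
  then obtain \<alpha> \<beta> where "w = \<alpha> *\<^sub>R x q + \<beta> *\<^sub>R y q" by blast
  then have "w = frechet_derivative z (at q) (\<alpha> / a q, \<beta> / a q)"
    using a_pos [OF assms] by (simp add: frechet_z [OF assms])
  then show "w \<in> tangent_space z q"
    by (simp add: tangent_space_def)
qed

lemma tangent_frame:
  assumes "q \<in> S"
  shows "x q \<in> tangent_space z q" "y q \<in> tangent_space z q"
  using tangent_iff [OF assms, of "x q"] tangent_iff [OF assms, of "y q"]
  by (metis add.right_neutral scaleR_one scaleR_zero_left, metis add.left_neutral scaleR_one scaleR_zero_left)

lemma normal_iff:
  assumes "q \<in> S"
  shows "w \<in> normal_space z q \<longleftrightarrow> ip w (x q) = 0 \<and> ip w (y q) = 0"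
proof
  show "w \<in> normal_space z q \<Longrightarrow> ip w (x q) = 0 \<and> ip w (y q) = 0"
    using tangent_frame [OF assms] by (auto simp: normal_space_def)
  show "ip w (x q) = 0 \<and> ip w (y q) = 0 \<Longrightarrow> w \<in> normal_space z q"
    by (auto simp: normal_space_def tangent_iff [OF assms] ip_linear)
qed

lemma frame_combination_eq_iff:
  assumes "q \<in> S"
  shows "\<alpha> *\<^sub>R x q + \<beta> *\<^sub>R y q = \<gamma> *\<^sub>R x q + \<delta> *\<^sub>R y q \<longleftrightarrow> \<alpha> = \<gamma> \<and> \<beta> = \<delta>"
proof
  assume "\<alpha> *\<^sub>R x q + \<beta> *\<^sub>R y q = \<gamma> *\<^sub>R x q + \<delta> *\<^sub>R y q"
  then have "ip (\<alpha> *\<^sub>R x q + \<beta> *\<^sub>R y q) w = ip (\<gamma> *\<^sub>R x q + \<delta> *\<^sub>R y q) w" for w by simp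
  from this [of "x q"] this [of "y q"] show "\<alpha> = \<gamma> \<and> \<beta> = \<delta>"
    by (simp add: ip_linear frame_ip [OF assms])
qed simp

lemma inj_frechet_z:
  assumes "q \<in> S"
  shows "inj (frechet_derivative z (at q))"
  using a_pos [OF assms]
  by (intro injI) (simp add: frechet_z [OF assms] frame_combination_eq_iff [OF assms] prod_eq_iff)

lemma tangent_coords_eq:
  assumes "q \<in> S"
  shows "tangent_coords z q (\<alpha> *\<^sub>R x q + \<beta> *\<^sub>R y q) = (\<alpha> / a q, \<beta> / a q)"
proof -
  have "\<alpha> *\<^sub>R x q + \<beta> *\<^sub>R y q = frechet_derivative z (at q) (\<alpha> / a q, \<beta> / a q)"
    using a_pos [OF assms] by (simp add: frechet_z [OF assms])
  then show ?thesis
    unfolding tangent_coords_def by (simp only: inv_f_f [OF inj_frechet_z [OF assms]])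
qed

text \<open>The frame expansion splits w into a tangent and a normal vector. Pairing with
  \<open>n1\<close> and \<open>n2\<close> shows that no other splitting exists, which the definite
  description in \<open>normal_part\<close> requires.\<close>

lemma normal_part_eq:
  assumes "q \<in> S"
  shows "normal_part z q w = (\<epsilon> * ip w (n1 q)) *\<^sub>R n1 q - (\<epsilon> * ip w (n2 q)) *\<^sub>R n2 q"
    (is "_ = ?n")
  unfolding normal_part_def
proof (rule the_equality)
  have "w - ?n = ip w (x q) *\<^sub>R x q + (- ip w (y q)) *\<^sub>R y q"
    using orthonormal_frame_expansion [OF \<epsilon> frame [OF assms], of w] by (simp add: algebra_simps)
  then have "w - ?n \<in> tangent_space z q"
    unfolding tangent_iff [OF assms] by blast
  moreover have "?n \<in> normal_space z q"
    by (simp add: normal_iff ip_linear frame_ip assms)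
  ultimately show "?n \<in> normal_space z q \<and> w - ?n \<in> tangent_space z q" by blast
  fix n assume n': "n \<in> normal_space z q \<and> w - n \<in> tangent_space z q"
  obtain \<alpha> \<beta> where "w - n = \<alpha> *\<^sub>R x q + \<beta> *\<^sub>R y q"
    using n' tangent_iff [OF assms] by blast
  then have w: "w = n + \<alpha> *\<^sub>R x q + \<beta> *\<^sub>R y q" by (simp add: algebra_simps)
  have "n = (\<epsilon> * ip n (n1 q)) *\<^sub>R n1 q - (\<epsilon> * ip n (n2 q)) *\<^sub>R n2 q"
    using orthonormal_frame_expansion [OF \<epsilon> frame [OF assms], of n] n' normal_iff [OF assms]
    by simp
  then show "n = ?n" by (simp add: w ip_linear frame_ip [OF assms])
qed

lemma flat_deriv_eq:
  assumes "q \<in> S" and "smooth_on S w"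
  shows "flat_deriv z q (\<alpha> *\<^sub>R x q + \<beta> *\<^sub>R y q) w
    = (1 / a q) *\<^sub>R (\<alpha> *\<^sub>R partial_u w q + \<beta> *\<^sub>R partial_v w q)"
proof -
  have "w differentiable (at q)"
    using smooth_on_has_derivative [OF assms(2,1)] by (auto simp: differentiable_def)
  then show ?thesis
    by (simp add: flat_deriv_def tangent_coords_eq [OF assms(1)] frechet_derivative_eq_partials
        scaleR_add_right)
qed

lemma second_partials:
  assumes "q \<in> S"
  shows "partial_u (partial_u z) q = partial_u a q *\<^sub>R x q + a q *\<^sub>R partial_u x q"
    "partial_v (partial_u z) q = partial_v a q *\<^sub>R x q + a q *\<^sub>R partial_v x q"
    "partial_u (partial_v z) q = partial_u a q *\<^sub>R y q + a q *\<^sub>R partial_u y q"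
    "partial_v (partial_v z) q = partial_v a q *\<^sub>R y q + a q *\<^sub>R partial_v y q"
  using partial_cong [OF S assms zu] partial_cong [OF S assms zv]
    partial_bounded_bilinear [OF bounded_bilinear_scaleR smooth(1) smooth(3) assms]
    partial_bounded_bilinear [OF bounded_bilinear_scaleR smooth(1) smooth(4) assms]
  by simp_all

text \<open>The extension with constant coordinates is a combination of a x and a y with constant
  coefficients. Derivatives of a contribute only multiples of x and y, which the normal part
  removes.\<close>

lemma second_fundamental_form_eq:
  assumes "q \<in> S"
  shows "second_fundamental_form z q (\<alpha> *\<^sub>R x q + \<beta> *\<^sub>R y q) (\<gamma> *\<^sub>R x q + \<delta> *\<^sub>R y q)
    = (1 / a q) *\<^sub>R normal_part z q ((\<alpha> * \<gamma>) *\<^sub>R partial_u x q + (\<alpha> * \<delta>) *\<^sub>R partial_u y q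
        + (\<beta> * \<gamma>) *\<^sub>R partial_v x q + (\<beta> * \<delta>) *\<^sub>R partial_v y q)"
proof -
  define w where "w p = frechet_derivative z (at p) (\<gamma> / a q, \<delta> / a q)" for p
  define w' where "w' p = (\<gamma> / a q) *\<^sub>R partial_u z p + (\<delta> / a q) *\<^sub>R partial_v z p" for p
  have w: "smooth_on S w"
    unfolding w_def by (rule smooth_on_frechet_derivative [OF smooth(2)])
  have ww': "w p = w' p" if "p \<in> S" for p
    using that by (simp add: w_def w'_def frechet_z zu zv)
  note lin = partial_bounded_linear [OF bounded_linear_scaleR_right _ assms]
  note sm = smooth_on_bounded_linear [OF bounded_linear_scaleR_right S]
  have "partial_u w' q = (\<gamma> / a q) *\<^sub>R partial_u (partial_u z) q + (\<delta> / a q) *\<^sub>R partial_u (partial_v z) q"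
    and "partial_v w' q = (\<gamma> / a q) *\<^sub>R partial_v (partial_u z) q + (\<delta> / a q) *\<^sub>R partial_v (partial_v z) q"
    unfolding w'_def using smooth_on_partial [OF smooth(2)]
    by (simp_all add: partial_add [OF sm sm assms] lin)
  then have wu: "partial_u w q = (\<gamma> / a q) *\<^sub>R partial_u (partial_u z) q + (\<delta> / a q) *\<^sub>R partial_u (partial_v z) q"
    and wv: "partial_v w q = (\<gamma> / a q) *\<^sub>R partial_v (partial_u z) q + (\<delta> / a q) *\<^sub>R partial_v (partial_v z) q"
    using partial_cong [OF S assms ww'] by simp_all
  have "second_fundamental_form z q (\<alpha> *\<^sub>R x q + \<beta> *\<^sub>R y q) (\<gamma> *\<^sub>R x q + \<delta> *\<^sub>R y q)
      = normal_part z q (flat_deriv z q (\<alpha> *\<^sub>R x q + \<beta> *\<^sub>R y q) w)"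
    by (simp add: second_fundamental_form_def tangent_coords_eq [OF assms] w_def [abs_def])
  also have "flat_deriv z q (\<alpha> *\<^sub>R x q + \<beta> *\<^sub>R y q) w
      = (1 / a q) *\<^sub>R (\<alpha> *\<^sub>R partial_u w q + \<beta> *\<^sub>R partial_v w q)"
    by (rule flat_deriv_eq [OF assms w])
  also have "normal_part z q \<dots>
    = (1 / a q) *\<^sub>R normal_part z q ((\<alpha> * \<gamma>) *\<^sub>R partial_u x q + (\<alpha> * \<delta>) *\<^sub>R partial_u y q
        + (\<beta> * \<gamma>) *\<^sub>R partial_v x q + (\<beta> * \<delta>) *\<^sub>R partial_v y q)"
    using a_pos [OF assms]
    by (simp add: wu wv second_partials [OF assms] normal_part_eq [OF assms] ip_linear frame_ip [OF assms])
      (simp add: algebra_simps add_divide_distrib)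
  finally show ?thesis .
qed

lemma second_fundamental_form_frame:
  assumes "q \<in> S"
  shows "second_fundamental_form z q (x q) (x q) = (1 / a q) *\<^sub>R normal_part z q (partial_u x q)"
    "second_fundamental_form z q (x q) (y q) = (1 / a q) *\<^sub>R normal_part z q (partial_u y q)"
    "second_fundamental_form z q (y q) (y q) = (1 / a q) *\<^sub>R normal_part z q (partial_v y q)"
  using second_fundamental_form_eq [OF assms, of 1 0 1 0]
    second_fundamental_form_eq [OF assms, of 1 0 0 1] second_fundamental_form_eq [OF assms, of 0 1 0 1]
  by simp_all

lemma lorentz: "lorentz_surface z S"
  unfolding lorentz_surface_def
  using S smooth inj_frechet_z tangent_frame frame_ip by blast

lemma adapted_frame_on: "adapted_frame_on z S \<epsilon> x y n1 n2"
  unfolding adapted_frame_on_def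
  using \<epsilon> smooth tangent_frame frame by (auto simp: normal_iff frame_ip)

lemma coeff_eq:
  assumes "q \<in> S"
  shows "coeff_E z q = (a q)\<^sup>2" "coeff_F z q = 0" "coeff_G z q = - (a q)\<^sup>2"
  by (simp_all add: coeff_E_def coeff_F_def coeff_G_def zu zv assms ip_linear frame_ip power2_eq_square)

end

section \<open>The structure equations\<close>

text \<open>The data of the moving frame: \<open>a\<close> is the conformal factor, \<open>f1, f2\<close> are the partial
  derivatives of \<open>ln a\<close>, \<open>b1, b2\<close> the coefficients of the normal connection, and
  \<open>m = a \<mu>\<close>, \<open>n = a \<nu>\<close>.  The assumptions are the equations of Codazzi, Gauss and Ricci.\<close>

locale frame_coefficients =
  fixes \<epsilon> :: real and S :: "(real \<times> real) set"
    and a f1 f2 b1 b2 m n :: "real \<times> real \<Rightarrow> real"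
  assumes \<epsilon>_sign: "\<epsilon> \<in> {1, -1}" and open_S: "open S"
    and smooth_coeff: "smooth_on S a" "smooth_on S f1" "smooth_on S f2" "smooth_on S b1"
      "smooth_on S b2" "smooth_on S m" "smooth_on S n"
    and a_positive: "\<And>q. q \<in> S \<Longrightarrow> a q > 0"
    and da: "\<And>q. q \<in> S \<Longrightarrow> partial_u a q = a q * f1 q" "\<And>q. q \<in> S \<Longrightarrow> partial_v a q = a q * f2 q"
    and dm: "\<And>q. q \<in> S \<Longrightarrow> partial_u m q = b2 q * n q - f1 q * m q"
      "\<And>q. q \<in> S \<Longrightarrow> partial_v m q = b1 q * n q - f2 q * m q"
    and dn: "\<And>q. q \<in> S \<Longrightarrow> partial_u n q = b2 q * m q - f1 q * n q"
      "\<And>q. q \<in> S \<Longrightarrow> partial_v n q = b1 q * m q - f2 q * n q"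
    and gauss: "\<And>q. q \<in> S \<Longrightarrow> partial_u f1 q - partial_v f2 q = \<epsilon> * ((m q)\<^sup>2 + (n q)\<^sup>2)"
    and ricci: "\<And>q. q \<in> S \<Longrightarrow> partial_u b2 q - partial_v b1 q = - 2 * \<epsilon> * m q * n q"

text \<open>Everything except the derivatives of the frame vectors. For the constructed surface
  these come from the linear system, for a given surface from its second fundamental form.\<close>

locale geometric_coefficients =
  conformal_frame \<epsilon> S a z x y n1 n2 + frame_coefficients \<epsilon> S a f1 f2 b1 b2 m n
  for \<epsilon> S a z x y n1 n2 f1 f2 b1 b2 m n +
  fixes \<mu> \<nu> :: "real \<times> real \<Rightarrow> real"
  assumes m: "\<And>q. q \<in> S \<Longrightarrow> m q = a q * \<mu> q" and n: "\<And>q. q \<in> S \<Longrightarrow> n q = a q * \<nu> q"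
    and nonzero: "\<And>q. q \<in> S \<Longrightarrow> \<mu> q * \<nu> q \<noteq> 0" "\<And>q. q \<in> S \<Longrightarrow> (\<mu> q)\<^sup>2 - (\<nu> q)\<^sup>2 \<noteq> 0"
    and a_eq: "\<And>q. q \<in> S \<Longrightarrow> (a q)\<^sup>2 = 1 / sqrt \<bar>(\<mu> q)\<^sup>2 - (\<nu> q)\<^sup>2\<bar>"

text \<open>The formulas of Gauss and Weingarten. The metric a^2 (du^2 - dv^2) has the connection
  form \<open>f2\<close> du + \<open>f1\<close> dv, so the derivatives of ln a occur crosswise; the
  signs in \<open>dn1\<close> and \<open>dn2\<close> are those of an infinitesimal orthogonal
  transformation.\<close>

locale structure_equations = geometric_coefficients +
  assumes dx: "\<And>q. q \<in> S \<Longrightarrow> partial_u x q = f2 q *\<^sub>R y q + n q *\<^sub>R n1 q"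
      "\<And>q. q \<in> S \<Longrightarrow> partial_v x q = f1 q *\<^sub>R y q + m q *\<^sub>R n2 q"
    and dy: "\<And>q. q \<in> S \<Longrightarrow> partial_u y q = f2 q *\<^sub>R x q + m q *\<^sub>R n2 q"
      "\<And>q. q \<in> S \<Longrightarrow> partial_v y q = f1 q *\<^sub>R x q + n q *\<^sub>R n1 q"
    and dn1: "\<And>q. q \<in> S \<Longrightarrow> partial_u n1 q = - (\<epsilon> * n q) *\<^sub>R x q + b1 q *\<^sub>R n2 q"
      "\<And>q. q \<in> S \<Longrightarrow> partial_v n1 q = (\<epsilon> * n q) *\<^sub>R y q + b2 q *\<^sub>R n2 q"
    and dn2: "\<And>q. q \<in> S \<Longrightarrow> partial_u n2 q = - (\<epsilon> * m q) *\<^sub>R y q + b1 q *\<^sub>R n1 q"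
      "\<And>q. q \<in> S \<Longrightarrow> partial_v n2 q = (\<epsilon> * m q) *\<^sub>R x q + b2 q *\<^sub>R n1 q"
begin

lemma sigma_eq:
  assumes "q \<in> S"
  shows "second_fundamental_form z q (\<alpha> *\<^sub>R x q + \<beta> *\<^sub>R y q) (\<gamma> *\<^sub>R x q + \<delta> *\<^sub>R y q)
    = ((\<alpha> * \<gamma> + \<beta> * \<delta>) * \<nu> q) *\<^sub>R n1 q + ((\<alpha> * \<delta> + \<beta> * \<gamma>) * \<mu> q) *\<^sub>R n2 q"
  using a_pos [OF assms]
  by (simp add: second_fundamental_form_eq normal_part_eq dx dy assms ip_linear frame_ip m n \<epsilon>\<epsilon>)
    (simp add: algebra_simps \<epsilon>\<epsilon>)

lemma sigma_frame:
  assumes "q \<in> S"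
  shows "second_fundamental_form z q (x q) (x q) = \<nu> q *\<^sub>R n1 q"
    "second_fundamental_form z q (y q) (y q) = \<nu> q *\<^sub>R n1 q"
    "second_fundamental_form z q (x q) (y q) = \<mu> q *\<^sub>R n2 q"
  using sigma_eq [OF assms, of 1 0 1 0] sigma_eq [OF assms, of 0 1 0 1] sigma_eq [OF assms, of 1 0 0 1]
  by simp_all

lemma minimal: "minimal_lorentz_surface z S"
  unfolding minimal_lorentz_surface_def
proof (intro conjI ballI lorentz)
  fix q assume q: "q \<in> S"
  have "second_fundamental_form z q (partial_u z q) (partial_u z q) = ((a q)\<^sup>2 * \<nu> q) *\<^sub>R n1 q"
    "second_fundamental_form z q (partial_v z q) (partial_v z q) = ((a q)\<^sup>2 * \<nu> q) *\<^sub>R n1 q"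
    using sigma_eq [OF q, of "a q" 0 "a q" 0] sigma_eq [OF q, of 0 "a q" 0 "a q"]
    by (simp_all add: zu zv q power2_eq_square)
  then show "mean_curvature_vector z q = 0"
    by (simp add: mean_curvature_vector_def coeff_eq q)
qed

lemma first_normal_space_eq:
  assumes "q \<in> S"
  shows "first_normal_space z q = span {n1 q, n2 q}"
  unfolding first_normal_space_def
proof (rule span_unique)
  show "{second_fundamental_form z q X Y |X Y. X \<in> tangent_space z q \<and> Y \<in> tangent_space z q}
      \<subseteq> span {n1 q, n2 q}"
  proof clarify
    fix X Y assume "X \<in> tangent_space z q" "Y \<in> tangent_space z q"
    then obtain \<alpha> \<beta> \<gamma> \<delta> where "X = \<alpha> *\<^sub>R x q + \<beta> *\<^sub>R y q" "Y = \<gamma> *\<^sub>R x q + \<delta> *\<^sub>R y q"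
      unfolding tangent_iff [OF assms] by blast
    then show "second_fundamental_form z q X Y \<in> span {n1 q, n2 q}"
      by (simp add: sigma_eq [OF assms] span_add span_scale span_base)
  qed
  show "subspace (span {n1 q, n2 q})" by (rule subspace_span)
  fix T assume T: "{second_fundamental_form z q X Y |X Y. X \<in> tangent_space z q \<and> Y \<in> tangent_space z q}
      \<subseteq> T" and "subspace T"
  have "second_fundamental_form z q (x q) (x q) \<in> T" "second_fundamental_form z q (x q) (y q) \<in> T"
    using T tangent_frame [OF assms] by blast+
  then have "\<nu> q *\<^sub>R n1 q \<in> T" "\<mu> q *\<^sub>R n2 q \<in> T"
    by (simp_all add: sigma_frame assms)
  then have "(1 / \<nu> q) *\<^sub>R \<nu> q *\<^sub>R n1 q \<in> T" "(1 / \<mu> q) *\<^sub>R \<mu> q *\<^sub>R n2 q \<in> T"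
    using \<open>subspace T\<close> subspace_scale by blast+
  then have "n1 q \<in> T" "n2 q \<in> T"
    using nonzero(1) [OF assms] by simp_all
  then show "span {n1 q, n2 q} \<subseteq> T"
    using \<open>subspace T\<close> by (intro span_minimal) auto
qed

lemma dim_first_normal_space:
  assumes "q \<in> S"
  shows "dim (first_normal_space z q) = 2"
proof -
  have "\<epsilon> \<noteq> 0" using \<epsilon> by auto
  have "n1 q \<notin> span {n2 q}"
  proof
    assume "n1 q \<in> span {n2 q}"
    then obtain k where "n1 q = k *\<^sub>R n2 q" by (auto simp: span_singleton)
    then have "ip (n1 q) (n1 q) = k * ip (n2 q) (n1 q)" by (metis ip.scaleR_left real_scaleR_def)
    then show False using \<open>\<epsilon> \<noteq> 0\<close> by (simp add: frame_ip assms)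
  qed
  moreover have "n2 q \<noteq> 0"
    using \<open>\<epsilon> \<noteq> 0\<close> frame_ip(4) [OF assms] by (auto simp: ip.zero_left)
  moreover from calculation have "n1 q \<noteq> n2 q" by (auto intro: span_base)
  ultimately have "independent {n1 q, n2 q}" "card {n1 q, n2 q} = 2"
    by (simp_all add: independent_insert)
  then show ?thesis
    by (simp add: first_normal_space_eq assms dim_span dim_eq_card_independent)
qed

section \<open>Gauss curvature and normal curvature\<close>

lemma gauss_curvature_eq:
  assumes "q \<in> S"
  shows "gauss_curvature z q (x q) (y q) = - \<epsilon> * ((\<mu> q)\<^sup>2 + (\<nu> q)\<^sup>2)"
  by (simp add: gauss_curvature_def sigma_frame frame_ip assms ip_linear power2_eq_square algebra_simps)

lemma flat_deriv_frame:
  assumes "q \<in> S" and "smooth_on S w"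
  shows "flat_deriv z q (x q) w = (1 / a q) *\<^sub>R partial_u w q"
    and "flat_deriv z q (y q) w = (1 / a q) *\<^sub>R partial_v w q"
  using flat_deriv_eq [OF assms, of 1 0] flat_deriv_eq [OF assms, of 0 1] by simp_all

lemma normal_connection_n1:
  assumes "q \<in> S"
  shows "normal_connection z x n1 q = (b1 q / a q) *\<^sub>R n2 q"
    and "normal_connection z y n1 q = (b2 q / a q) *\<^sub>R n2 q"
  by (simp_all add: normal_connection_def flat_deriv_frame normal_part_eq dn1 smooth assms
      ip_linear frame_ip \<epsilon>\<epsilon>)

lemma a_nonzero: "q \<in> S \<Longrightarrow> a q \<noteq> 0"
  using a_pos by fastforce

text \<open>The product rule for b = t a, together with the equations for the derivatives of a,
  gives those of t = b / a.\<close>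

lemma partial_over_a:
  assumes "q \<in> S" and "smooth_on S b"
  shows "partial_u (\<lambda>p. (b p / a p) *\<^sub>R n2 p) q
      = ((partial_u b q - b q * f1 q) / a q) *\<^sub>R n2 q + (b q / a q) *\<^sub>R partial_u n2 q"
    and "partial_v (\<lambda>p. (b p / a p) *\<^sub>R n2 p) q
      = ((partial_v b q - b q * f2 q) / a q) *\<^sub>R n2 q + (b q / a q) *\<^sub>R partial_v n2 q"
proof -
  define t where "t p = b p / a p" for p
  have t: "smooth_on S t"
    unfolding t_def by (intro smooth_on_divide S smooth assms a_nonzero)
  have b: "b p = t p * a p" if "p \<in> S" for p
    using a_pos [OF that] by (simp add: t_def)
  have "partial_u b q = partial_u t q * a q + t q * (a q * f1 q)"
    "partial_v b q = partial_v t q * a q + t q * (a q * f2 q)"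
    using partial_cong [OF S assms(1) b]
      partial_bounded_bilinear [OF bounded_bilinear_mult t smooth(1) assms(1)] da [OF assms(1)]
    by simp_all
  then have "partial_u t q = (partial_u b q - b q * f1 q) / a q"
    "partial_v t q = (partial_v b q - b q * f2 q) / a q"
    using a_pos [OF assms(1)] b [OF assms(1)] by (simp_all add: field_simps)
  then show "partial_u (\<lambda>p. (b p / a p) *\<^sub>R n2 p) q
      = ((partial_u b q - b q * f1 q) / a q) *\<^sub>R n2 q + (b q / a q) *\<^sub>R partial_u n2 q"
    and "partial_v (\<lambda>p. (b p / a p) *\<^sub>R n2 p) q
      = ((partial_v b q - b q * f2 q) / a q) *\<^sub>R n2 q + (b q / a q) *\<^sub>R partial_v n2 q"
    using partial_bounded_bilinear [OF bounded_bilinear_scaleR t smooth(6) assms(1)]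
    by (simp_all add: t_def)
qed

text \<open>The normal bundle has rank two, so its curvature is governed by the exterior derivative
  of the connection form \<open>b1\<close> du + \<open>b2\<close> dv, which the Ricci equation
  evaluates. The terms in \<open>f1\<close>, \<open>f2\<close> from differentiating 1 / a cancel
  against the Lie bracket, and the two terms \<open>b1 b2\<close> cancel each other.\<close>

lemma normal_curvature_eq:
  assumes "q \<in> S"
  shows "normal_curvature z x y n1 n2 q = - 2 * \<mu> q * \<nu> q"
proof -
  have sm: "smooth_on S (\<lambda>p. (b p / a p) *\<^sub>R n2 p)" if "smooth_on S b" for b
    by (intro smooth_on_scaleR smooth_on_divide S smooth that a_nonzero)
  have c1: "smooth_on S (normal_connection z x n1)" and c2: "smooth_on S (normal_connection z y n1)"
    by (simp_all only: smooth_on_cong [OF S normal_connection_n1(1)]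
        smooth_on_cong [OF S normal_connection_n1(2)] sm smooth_coeff)
  have "flat_deriv z q (y q) (normal_connection z x n1)
      = (1 / a q) *\<^sub>R partial_v (\<lambda>p. (b1 p / a p) *\<^sub>R n2 p) q"
    "flat_deriv z q (x q) (normal_connection z y n1)
      = (1 / a q) *\<^sub>R partial_u (\<lambda>p. (b2 p / a p) *\<^sub>R n2 p) q"
    using partial_cong [OF S assms normal_connection_n1(1)]
      partial_cong [OF S assms normal_connection_n1(2)]
    by (simp_all add: flat_deriv_frame assms c1 c2)
  then have yx: "normal_connection z y (normal_connection z x n1) q
      = (1 / (a q)\<^sup>2) *\<^sub>R ((partial_v b1 q - b1 q * f2 q) *\<^sub>R n2 q + (b1 q * b2 q) *\<^sub>R n1 q)"
    and xy: "normal_connection z x (normal_connection z y n1) q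
      = (1 / (a q)\<^sup>2) *\<^sub>R ((partial_u b2 q - b2 q * f1 q) *\<^sub>R n2 q + (b1 q * b2 q) *\<^sub>R n1 q)"
    by (simp_all add: normal_connection_def partial_over_a smooth_coeff normal_part_eq dn2 assms
        ip_linear frame_ip \<epsilon>\<epsilon> power2_eq_square mult_ac scaleR_add_right)
  have "lie_bracket z x y q = (f2 q / a q) *\<^sub>R x q + (- f1 q / a q) *\<^sub>R y q"
    by (simp add: lie_bracket_def flat_deriv_frame assms smooth dx dy algebra_simps)
  then have "flat_deriv z q (lie_bracket z x y q) n1
      = (1 / a q) *\<^sub>R ((f2 q / a q) *\<^sub>R partial_u n1 q + (- f1 q / a q) *\<^sub>R partial_v n1 q)"
    by (simp only: flat_deriv_eq [OF assms smooth(5)])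
  then have lie: "normal_connection z (lie_bracket z x y) n1 q
      = (1 / (a q)\<^sup>2) *\<^sub>R (f2 q * b1 q - f1 q * b2 q) *\<^sub>R n2 q"
    by (simp add: normal_connection_def normal_part_eq dn1 assms ip_linear frame_ip)
      (simp add: algebra_simps \<epsilon>\<epsilon> power2_eq_square diff_divide_distrib)
  have "normal_curvature_tensor z x y n1 q
      = (1 / (a q)\<^sup>2) *\<^sub>R (partial_u b2 q - partial_v b1 q) *\<^sub>R n2 q"
    by (simp add: normal_curvature_tensor_def xy yx lie algebra_simps)
  also have "\<dots> = (- 2 * \<epsilon> * \<mu> q * \<nu> q) *\<^sub>R n2 q"
    using a_pos [OF assms] by (simp add: ricci assms m n power2_eq_square)
  finally show ?thesis
    by (simp add: normal_curvature_def assms ip_linear frame_ip \<epsilon>\<epsilon> mult_ac)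
qed

text \<open>The difference of the squared curvatures is (\<mu>^2 - \<nu>^2)^2, positive at every
  point, so the dense open set is S itself.\<close>

lemma general_type: "minimal_general_type z S"
  unfolding minimal_general_type_def
proof (intro conjI ballI minimal dim_first_normal_space)
  have curv: "\<exists>V \<epsilon> x y n1 n2. open V \<and> q \<in> V \<and> V \<subseteq> S \<and> adapted_frame_on z V \<epsilon> x y n1 n2 \<and>
      (gauss_curvature z q (x q) (y q))\<^sup>2 - (normal_curvature z x y n1 n2 q)\<^sup>2 > 0" if q: "q \<in> S" for q
  proof -
    have "(gauss_curvature z q (x q) (y q))\<^sup>2 - (normal_curvature z x y n1 n2 q)\<^sup>2
        = ((\<mu> q)\<^sup>2 - (\<nu> q)\<^sup>2)\<^sup>2"
      unfolding gauss_curvature_eq [OF q] normal_curvature_eq [OF q]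
      using \<epsilon> by (auto simp: power2_eq_square algebra_simps)
    also have "\<dots> > 0" using nonzero(2) [OF q] by simp
    finally show ?thesis
      using S q adapted_frame_on
      by (intro exI [of _ S] exI [of _ \<epsilon>] exI [of _ x] exI [of _ y] exI [of _ n1] exI [of _ n2]) simp
  qed
  show "\<exists>W. open W \<and> W \<subseteq> S \<and> S \<subseteq> closure W \<and>
      (\<forall>q\<in>W. \<exists>V \<epsilon> x y n1 n2. open V \<and> q \<in> V \<and> V \<subseteq> S \<and> adapted_frame_on z V \<epsilon> x y n1 n2 \<and>
        (gauss_curvature z q (x q) (y q))\<^sup>2 - (normal_curvature z x y n1 n2 q)\<^sup>2 > 0)"
    by (rule exI [of _ S], intro conjI ballI S subset_refl closure_subset curv)
qed

lemma geometric: "geometric_frame_field z S \<epsilon> \<mu> \<nu> x y n1 n2"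
  unfolding geometric_frame_field_def using adapted_frame_on sigma_frame nonzero(1) by blast

lemma canonical: "canonical_parameters z S \<mu> \<nu> x y"
  unfolding canonical_parameters_def
  using a_pos by (auto simp: coeff_eq zu zv a_eq less_imp_le simp flip: a_eq)

end

subsection \<open>Deriving the structure equations from the second fundamental form\<close>

context geometric_coefficients
begin

lemma normal_part_eqD:
  assumes "q \<in> S" and "normal_part z q w = \<gamma> *\<^sub>R n1 q + \<delta> *\<^sub>R n2 q"
  shows "ip w (n1 q) = \<epsilon> * \<gamma>" "ip w (n2 q) = - \<epsilon> * \<delta>"
proof -
  have "ip ((\<epsilon> * ip w (n1 q)) *\<^sub>R n1 q - (\<epsilon> * ip w (n2 q)) *\<^sub>R n2 q) v
      = ip (\<gamma> *\<^sub>R n1 q + \<delta> *\<^sub>R n2 q) v" for v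
    using assms by (simp add: normal_part_eq)
  from this [of "n1 q"] this [of "n2 q"]
  show "ip w (n1 q) = \<epsilon> * \<gamma>" "ip w (n2 q) = - \<epsilon> * \<delta>"
    using \<epsilon>\<epsilon> by (simp_all add: ip_linear frame_ip assms(1) algebra_simps)
qed

lemma ip_partial:
  assumes "q \<in> S" and "smooth_on S f" and "smooth_on S g" and "\<And>p. p \<in> S \<Longrightarrow> ip (f p) (g p) = k"
  shows "ip (partial_u g q) (f q) = - ip (partial_u f q) (g q)"
    and "ip (partial_v g q) (f q) = - ip (partial_v f q) (g q)"
proof -
  have "partial_u (\<lambda>p. ip (f p) (g p)) q = 0" "partial_v (\<lambda>p. ip (f p) (g p)) q = 0"
    using partial_cong [OF S assms(1), of "\<lambda>p. ip (f p) (g p)" "\<lambda>p. k"] assms(4) by simp_all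
  then show "ip (partial_u g q) (f q) = - ip (partial_u f q) (g q)"
    and "ip (partial_v g q) (f q) = - ip (partial_v f q) (g q)"
    using partial_bounded_bilinear [OF bounded_bilinear_ip assms(2,3,1)]
      ip_commute [of "partial_u g q" "f q"] ip_commute [of "partial_v g q" "f q"]
    by simp_all
qed

text \<open>The tangential coefficients follow from the equality of the mixed derivatives of z, the
  normal ones from \<sigma>, and most others from differentiating constant scalar products. The
  normal connection is left, and the Codazzi equations identify it.\<close>

lemma structure_equationsI:
  assumes \<sigma>: "\<And>q. q \<in> S \<Longrightarrow> second_fundamental_form z q (x q) (x q) = \<nu> q *\<^sub>R n1 q"
    "\<And>q. q \<in> S \<Longrightarrow> second_fundamental_form z q (y q) (y q) = \<nu> q *\<^sub>R n1 q"
    "\<And>q. q \<in> S \<Longrightarrow> second_fundamental_form z q (x q) (y q) = \<mu> q *\<^sub>R n2 q"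
  shows "structure_equations \<epsilon> S a z x y n1 n2 f1 f2 b1 b2 m n \<mu> \<nu>"
proof -
  \<comment> \<open>The normal connection of the given frame, not yet known to be \<open>b1\<close>,
    \<open>b2\<close>.\<close>
  define g1 where "g1 q = - \<epsilon> * ip (partial_u n1 q) (n2 q)" for q
  define g2 where "g2 q = - \<epsilon> * ip (partial_v n1 q) (n2 q)" for q
  have eqs: "partial_u x q = f2 q *\<^sub>R y q + n q *\<^sub>R n1 q"
      "partial_v x q = f1 q *\<^sub>R y q + m q *\<^sub>R n2 q"
      "partial_u y q = f2 q *\<^sub>R x q + m q *\<^sub>R n2 q"
      "partial_v y q = f1 q *\<^sub>R x q + n q *\<^sub>R n1 q"
      "partial_u n1 q = - (\<epsilon> * n q) *\<^sub>R x q + g1 q *\<^sub>R n2 q"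
      "partial_v n1 q = (\<epsilon> * n q) *\<^sub>R y q + g2 q *\<^sub>R n2 q"
      "partial_u n2 q = - (\<epsilon> * m q) *\<^sub>R y q + g1 q *\<^sub>R n1 q"
      "partial_v n2 q = (\<epsilon> * m q) *\<^sub>R x q + g2 q *\<^sub>R n1 q" if q: "q \<in> S" for q
  proof -
    have a: "a q > 0" by (rule a_pos [OF q])
    note sm = smooth(3-6)
    note ips = frame_ip
    have diag: "ip (partial_u w q) (w q) = 0 \<and> ip (partial_v w q) (w q) = 0"
      if "smooth_on S w" "\<And>p. p \<in> S \<Longrightarrow> ip (w p) (w p) = k" for w k
      using ip_partial [OF q that(1,1) that(2)] by simp
    have d: "ip (partial_u x q) (x q) = 0" "ip (partial_v x q) (x q) = 0"
      "ip (partial_u y q) (y q) = 0" "ip (partial_v y q) (y q) = 0"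
      "ip (partial_u n1 q) (n1 q) = 0" "ip (partial_v n1 q) (n1 q) = 0"
      "ip (partial_u n2 q) (n2 q) = 0" "ip (partial_v n2 q) (n2 q) = 0"
      using diag [OF sm(1) ips(1)] diag [OF sm(2) ips(2)] diag [OF sm(3) ips(3)] diag [OF sm(4) ips(4)]
      by simp_all
    have sym: "partial_v a q *\<^sub>R x q + a q *\<^sub>R partial_v x q
        = partial_u a q *\<^sub>R y q + a q *\<^sub>R partial_u y q"
      using symmetric_second_partials [OF S q smooth(2)] by (simp add: second_partials q)
    have sym': "ip (partial_v x q) w = f1 q * ip (y q) w + ip (partial_u y q) w - f2 q * ip (x q) w" for w
    proof -
      have "a q * ip (partial_v x q) w
          = a q * (f1 q * ip (y q) w + ip (partial_u y q) w - f2 q * ip (x q) w)"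
        using arg_cong [OF sym, of "\<lambda>v. ip v w"] by (simp add: ip_linear da q algebra_simps)
      then show ?thesis using a by (metis less_irrefl mult_left_cancel)
    qed
    have N: "normal_part z q (partial_u x q) = n q *\<^sub>R n1 q + 0 *\<^sub>R n2 q"
      "normal_part z q (partial_v y q) = n q *\<^sub>R n1 q + 0 *\<^sub>R n2 q"
      "normal_part z q (partial_u y q) = 0 *\<^sub>R n1 q + m q *\<^sub>R n2 q"
    proof -
      have "normal_part z q (partial_u x q) = a q *\<^sub>R second_fundamental_form z q (x q) (x q)"
        "normal_part z q (partial_v y q) = a q *\<^sub>R second_fundamental_form z q (y q) (y q)"
        "normal_part z q (partial_u y q) = a q *\<^sub>R second_fundamental_form z q (x q) (y q)"
        using a by (simp_all add: second_fundamental_form_frame q)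
      then show "normal_part z q (partial_u x q) = n q *\<^sub>R n1 q + 0 *\<^sub>R n2 q"
        "normal_part z q (partial_v y q) = n q *\<^sub>R n1 q + 0 *\<^sub>R n2 q"
        "normal_part z q (partial_u y q) = 0 *\<^sub>R n1 q + m q *\<^sub>R n2 q"
        by (simp_all add: \<sigma> m n q)
    qed
    have t: "ip (partial_u y q) (x q) = f2 q" "ip (partial_v x q) (y q) = - f1 q"
      using sym' [of "x q"] sym' [of "y q"] by (simp_all add: q ips d)
    have t': "ip (partial_u x q) (y q) = - f2 q" "ip (partial_v y q) (x q) = f1 q"
      using ip_partial(1) [OF q sm(2,1) ips(11)] ip_partial(2) [OF q sm(1,2) ips(5)] t
      by simp_all
    have X: "ip (partial_u x q) (n1 q) = \<epsilon> * n q" "ip (partial_u x q) (n2 q) = 0"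
      "ip (partial_v y q) (n1 q) = \<epsilon> * n q" "ip (partial_v y q) (n2 q) = 0"
      "ip (partial_u y q) (n1 q) = 0" "ip (partial_u y q) (n2 q) = - \<epsilon> * m q"
      using normal_part_eqD [OF q N(1)] normal_part_eqD [OF q N(2)] normal_part_eqD [OF q N(3)]
      by simp_all
    have X': "ip (partial_v x q) (n1 q) = 0" "ip (partial_v x q) (n2 q) = - \<epsilon> * m q"
      using sym' [of "n1 q"] sym' [of "n2 q"] X by (simp_all add: q ips)
    have M: "ip (partial_u n1 q) (x q) = - \<epsilon> * n q" "ip (partial_v n1 q) (x q) = 0"
      "ip (partial_u n1 q) (y q) = 0" "ip (partial_v n1 q) (y q) = - \<epsilon> * n q"
      "ip (partial_u n2 q) (x q) = 0" "ip (partial_v n2 q) (x q) = \<epsilon> * m q"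
      "ip (partial_u n2 q) (y q) = \<epsilon> * m q" "ip (partial_v n2 q) (y q) = 0"
      using ip_partial [OF q sm(1,3) ips(6)] ip_partial [OF q sm(1,4) ips(7)]
        ip_partial [OF q sm(2,3) ips(8)] ip_partial [OF q sm(2,4) ips(9)] X X'
      by simp_all
    have G: "ip (partial_u n1 q) (n2 q) = - \<epsilon> * g1 q" "ip (partial_v n1 q) (n2 q) = - \<epsilon> * g2 q"
      by (simp_all add: g1_def g2_def \<epsilon>\<epsilon>)
    have G': "ip (partial_u n2 q) (n1 q) = \<epsilon> * g1 q" "ip (partial_v n2 q) (n1 q) = \<epsilon> * g2 q"
      using ip_partial [OF q sm(3,4) ips(10)] G by simp_all
    note expand = orthonormal_frame_expansion [OF \<epsilon> frame [OF q]]
    show "partial_u x q = f2 q *\<^sub>R y q + n q *\<^sub>R n1 q"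
      "partial_v x q = f1 q *\<^sub>R y q + m q *\<^sub>R n2 q"
      "partial_u y q = f2 q *\<^sub>R x q + m q *\<^sub>R n2 q"
      "partial_v y q = f1 q *\<^sub>R x q + n q *\<^sub>R n1 q"
      "partial_u n1 q = - (\<epsilon> * n q) *\<^sub>R x q + g1 q *\<^sub>R n2 q"
      "partial_v n1 q = (\<epsilon> * n q) *\<^sub>R y q + g2 q *\<^sub>R n2 q"
      "partial_u n2 q = - (\<epsilon> * m q) *\<^sub>R y q + g1 q *\<^sub>R n1 q"
      "partial_v n2 q = (\<epsilon> * m q) *\<^sub>R x q + g2 q *\<^sub>R n1 q"
      by (rule trans [OF expand], simp add: d t t' X X' M G G' \<epsilon>\<epsilon>)+
  qed
  have g: "g1 q = b1 q \<and> g2 q = b2 q" if q: "q \<in> S" for q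
  proof -
    note prod = partial_bounded_bilinear [OF bounded_bilinear_scaleR _ _ q]
    note sm = smooth(3-6) smooth_coeff
    have "partial_v (partial_u x) q = partial_v (\<lambda>p. f2 p *\<^sub>R y p + n p *\<^sub>R n1 p) q"
      by (rule partial_cong [OF S q eqs(1)])
    also have "\<dots> = partial_v f2 q *\<^sub>R y q + f2 q *\<^sub>R partial_v y q
        + (partial_v n q *\<^sub>R n1 q + n q *\<^sub>R partial_v n1 q)"
      using sm by (simp add: partial_add [OF smooth_on_scaleR smooth_on_scaleR q] S prod)
    finally have vu: "partial_v (partial_u x) q = partial_v f2 q *\<^sub>R y q + f2 q *\<^sub>R partial_v y q
        + (partial_v n q *\<^sub>R n1 q + n q *\<^sub>R partial_v n1 q)" .
    have "partial_u (partial_v x) q = partial_u (\<lambda>p. f1 p *\<^sub>R y p + m p *\<^sub>R n2 p) q"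
      by (rule partial_cong [OF S q eqs(2)])
    also have "\<dots> = partial_u f1 q *\<^sub>R y q + f1 q *\<^sub>R partial_u y q
        + (partial_u m q *\<^sub>R n2 q + m q *\<^sub>R partial_u n2 q)"
      using sm by (simp add: partial_add [OF smooth_on_scaleR smooth_on_scaleR q] S prod)
    finally have eq: "partial_v f2 q *\<^sub>R y q + f2 q *\<^sub>R partial_v y q
        + (partial_v n q *\<^sub>R n1 q + n q *\<^sub>R partial_v n1 q)
        = partial_u f1 q *\<^sub>R y q + f1 q *\<^sub>R partial_u y q
        + (partial_u m q *\<^sub>R n2 q + m q *\<^sub>R partial_u n2 q)"
      using vu symmetric_second_partials [OF S q smooth(3)] by simp
    \<comment> \<open>These are the normal components of the equality of the mixed derivatives of x.
      Comparison with \<open>dm\<close> and \<open>dn\<close> leaves m g1 = m b1 and n g2 = n b2,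
      where m and n do not vanish.\<close>
    have "f2 q * n q + partial_v n q = m q * g1 q" "n q * g2 q = f1 q * m q + partial_u m q"
      using arg_cong [OF eq, of "\<lambda>w. \<epsilon> * ip w (n1 q)"] arg_cong [OF eq, of "\<lambda>w. - \<epsilon> * ip w (n2 q)"]
      by (simp_all add: eqs q ip_linear frame_ip algebra_simps \<epsilon>\<epsilon>)
    then have "m q * b1 q = m q * g1 q" "n q * g2 q = n q * b2 q"
      by (simp_all add: dm dn q algebra_simps)
    then show ?thesis
      using nonzero(1) [OF q] a_pos [OF q] by (simp add: m n q)
  qed
  show ?thesis
    by unfold_locales (simp_all add: eqs g)
qed

end

subsection \<open>The structure equations as a flat linear system\<close>

type_synonym framing = "(real^4) \<times> (real^4) \<times> (real^4) \<times> (real^4) \<times> (real^4)"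

type_synonym framing_coeffs = "real \<times> real \<times> real \<times> real \<times> real \<times> real \<times> real \<times> real"

text \<open>A framing consists of a point and a frame there; the first six coefficients describe
  an element of the Lie algebra of the orthogonal group of signature (2,2), the last two the
  velocity of the point.\<close>

definition framing_action :: "real \<Rightarrow> framing_coeffs \<Rightarrow> framing \<Rightarrow> framing" where
  "framing_action \<epsilon> = (\<lambda>(k1, k2, k3, k4, k5, k6, k7, k8) (z, x, y, n1, n2).
    (k7 *\<^sub>R x + k8 *\<^sub>R y,
     k1 *\<^sub>R y + k2 *\<^sub>R n1 + k3 *\<^sub>R n2,
     k1 *\<^sub>R x + k4 *\<^sub>R n1 + k5 *\<^sub>R n2,
     - (\<epsilon> * k2) *\<^sub>R x + (\<epsilon> * k4) *\<^sub>R y + k6 *\<^sub>R n2,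
     (\<epsilon> * k3) *\<^sub>R x - (\<epsilon> * k5) *\<^sub>R y + k6 *\<^sub>R n1))"

lemma bounded_bilinear_framing_action: "bounded_bilinear (framing_action \<epsilon>)"
proof -
  have "bilinear (framing_action \<epsilon>)"
    by (auto simp: bilinear_def framing_action_def algebra_simps intro!: linearI)
  then show ?thesis by (simp add: bilinear_conv_bounded_bilinear)
qed

text \<open>The polarised column relation for the indices i and k, bilinear so that the product rule
  applies.\<close>

definition frame_form :: "real \<Rightarrow> 4 \<Rightarrow> 4 \<Rightarrow> framing \<Rightarrow> framing \<Rightarrow> real" where
  "frame_form \<epsilon> i k = (\<lambda>(z, x, y, n1, n2) (z', x', y', n1', n2').
    x $ i * x' $ k - y $ i * y' $ k + \<epsilon> * (n1 $ i * n1' $ k) - \<epsilon> * (n2 $ i * n2' $ k))"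

lemma bounded_bilinear_frame_form: "bounded_bilinear (frame_form \<epsilon> i k)"
proof -
  have "bilinear (frame_form \<epsilon> i k)"
    by (auto simp: bilinear_def frame_form_def algebra_simps intro!: linearI)
  then show ?thesis by (simp add: bilinear_conv_bounded_bilinear)
qed

text \<open>The action on the frame vectors has a matrix that is skew for the signs 1, -1,
  \<epsilon>, -\<epsilon>, and the form contracts exactly the frame index with these signs.\<close>

lemma frame_form_skew:
  assumes "\<epsilon> \<in> {1, -1}"
  shows "frame_form \<epsilon> i k V (framing_action \<epsilon> K V) + frame_form \<epsilon> i k (framing_action \<epsilon> K V) V = 0"
proof -
  obtain z x y n1 n2 where V: "V = (z, x, y, n1, n2)" by (cases V)
  obtain k1 L where "K = (k1, L)" by (cases K)
  moreover obtain k2 k3 k4 k5 k6 k7 k8 where "L = (k2, k3, k4, k5, k6, k7, k8)" by (cases L)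
  ultimately have K: "K = (k1, k2, k3, k4, k5, k6, k7, k8)" by simp
  from assms consider "\<epsilon> = 1" | "\<epsilon> = -1" by auto
  then show ?thesis
    by cases (simp_all add: V K frame_form_def framing_action_def algebra_simps)
qed

text \<open>The matrix of scalar products of the frame vectors obeys only another linear equation,
  whereas each column relation has derivative zero by skewness. Orthonormality thus propagates from
  a single point directly.\<close>

lemma frame_form_constant:
  assumes "\<epsilon> \<in> {1, -1}" and "convex T"
    and "\<And>p. p \<in> T \<Longrightarrow> (V has_derivative (\<lambda>h. framing_action \<epsilon> (M h p) (V p))) (at p)"
    and "p \<in> T" and "q \<in> T"
  shows "frame_form \<epsilon> i k (V p) (V p) = frame_form \<epsilon> i k (V q) (V q)"
proof -
  have "\<exists>c. \<forall>p\<in>T. frame_form \<epsilon> i k (V p) (V p) = c"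
  proof (rule has_derivative_zero_constant [OF \<open>convex T\<close>])
    fix p assume "p \<in> T"
    from bounded_bilinear.FDERIV [OF bounded_bilinear_frame_form [of \<epsilon> i k] assms(3) [OF this] assms(3) [OF this]]
    have "((\<lambda>p. frame_form \<epsilon> i k (V p) (V p)) has_derivative (\<lambda>h. 0)) (at p)"
      by (simp add: frame_form_skew [OF assms(1)])
    then show "((\<lambda>p. frame_form \<epsilon> i k (V p) (V p)) has_derivative (\<lambda>h. 0)) (at p within T)"
      by (rule has_derivative_at_withinI)
  qed
  with assms show ?thesis by metis
qed

context frame_coefficients
begin

definition coeffs_u :: "real \<times> real \<Rightarrow> framing_coeffs" where
  "coeffs_u q = (f2 q, n q, 0, 0, m q, b1 q, a q, 0)"

definition coeffs_v :: "real \<times> real \<Rightarrow> framing_coeffs" where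
  "coeffs_v q = (f1 q, 0, m q, n q, 0, b2 q, 0, a q)"

lemma smooth_on_coeffs: "smooth_on S coeffs_u" "smooth_on S coeffs_v"
  unfolding coeffs_u_def [abs_def] coeffs_v_def [abs_def]
  by (intro smooth_on_Pair open_S smooth_coeff smooth_on_const)+

text \<open>The point component is the pair of equations for the derivatives of a, the part between
  x and y is Gauss, the part between \<open>n1\<close> and \<open>n2\<close> is Ricci, and the
  tangent-normal parts are Codazzi.\<close>

lemma coeffs_flat:
  assumes "q \<in> S"
  shows "framing_action \<epsilon> (partial_v coeffs_u q) w
      + framing_action \<epsilon> (coeffs_u q) (framing_action \<epsilon> (coeffs_v q) w)
    = framing_action \<epsilon> (partial_u coeffs_v q) w
      + framing_action \<epsilon> (coeffs_v q) (framing_action \<epsilon> (coeffs_u q) w)"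
proof -
  note Pair = partial_Pair [OF _ _ assms] smooth_on_Pair open_S smooth_coeff smooth_on_const
  have v: "partial_v coeffs_u q
      = (partial_v f2 q, partial_v n q, 0, 0, partial_v m q, partial_v b1 q, partial_v a q, 0)"
    unfolding coeffs_u_def [abs_def] by (simp add: Pair)
  have u: "partial_u coeffs_v q
      = (partial_u f1 q, 0, partial_u m q, partial_u n q, 0, partial_u b2 q, 0, partial_u a q)"
    unfolding coeffs_v_def [abs_def] by (simp add: Pair)
  have f: "partial_u f1 q = partial_v f2 q + \<epsilon> * ((m q)\<^sup>2 + (n q)\<^sup>2)"
    and b: "partial_u b2 q = partial_v b1 q - (\<epsilon> * m q * n q + \<epsilon> * m q * n q)"
    using gauss [OF assms] ricci [OF assms] by simp_all
  obtain z x y n1 n2 where w: "w = (z, x, y, n1, n2)" by (cases w)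
  from \<epsilon>_sign consider "\<epsilon> = 1" | "\<epsilon> = -1" by auto
  then show ?thesis
    unfolding u v w coeffs_u_def coeffs_v_def framing_action_def
    by cases (simp_all add: da dm dn f b assms algebra_simps power2_eq_square,
        simp_all add: vec_eq_iff)
qed

end


lemma framing_actionE:
  assumes "(V has_derivative (\<lambda>h. framing_action \<epsilon> (fst h *\<^sub>R A + snd h *\<^sub>R B) (V p))) (at p)"
  shows "partial_u V p = framing_action \<epsilon> A (V p)" "partial_v V p = framing_action \<epsilon> B (V p)"
  using partial_eqI [OF assms] by simp_all

context frame_coefficients
begin

lemma frame_coefficients_subset:
  assumes "open T" and "T \<subseteq> S"
  shows "frame_coefficients \<epsilon> T a f1 f2 b1 b2 m n"
  using assms \<epsilon>_sign smooth_coeff [THEN smooth_on_subset, OF assms(2)]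
  by unfold_locales (auto simp: a_positive da dm dn gauss ricci)

end

context structure_equations
begin

text \<open>The direction used for uniqueness: any surface with the structure equations, together
  with its frame, solves the linear system.\<close>

lemma framing_solves:
  assumes "q \<in> S"
  defines "V \<equiv> \<lambda>q. (z q, x q, y q, n1 q, n2 q)"
  shows "(V has_derivative
    (\<lambda>h. framing_action \<epsilon> (fst h *\<^sub>R coeffs_u q + snd h *\<^sub>R coeffs_v q) (V q))) (at q)"
proof -
  interpret act: bounded_bilinear "framing_action \<epsilon>"
    by (rule bounded_bilinear_framing_action)
  have sm: "smooth_on S V"
    unfolding V_def by (intro smooth_on_Pair S smooth)
  have "partial_u V q = framing_action \<epsilon> (coeffs_u q) (V q)"
    "partial_v V q = framing_action \<epsilon> (coeffs_v q) (V q)"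
    unfolding V_def
    by (simp_all add: partial_Pair [OF _ _ assms(1)] smooth_on_Pair S smooth zu zv dx dy dn1 dn2 assms(1)
        framing_action_def coeffs_u_def coeffs_v_def)
  with smooth_on_has_derivative_partials [OF sm assms(1)] show ?thesis
    by (simp add: act.add_left act.scaleR_left)
qed

end

text \<open>The frame stays orthonormal because the linear system preserves the scalar products of the
  columns of the frame matrix.\<close>

lemma (in frame_coefficients) structure_equations_of_solution:
  assumes "convex S" and "c \<in> S" and "orthonormal_frame \<epsilon> x0 y0 n10 n20"
    and V: "\<And>q. q \<in> S \<Longrightarrow> (V has_derivative
      (\<lambda>h. framing_action \<epsilon> (fst h *\<^sub>R coeffs_u q + snd h *\<^sub>R coeffs_v q) (V q))) (at q)"
    and V0: "V c = (p0, x0, y0, n10, n20)"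
    and m: "\<And>q. q \<in> S \<Longrightarrow> m q = a q * \<mu> q" and n: "\<And>q. q \<in> S \<Longrightarrow> n q = a q * \<nu> q"
    and nonzero: "\<And>q. q \<in> S \<Longrightarrow> \<mu> q * \<nu> q \<noteq> 0" "\<And>q. q \<in> S \<Longrightarrow> (\<mu> q)\<^sup>2 - (\<nu> q)\<^sup>2 \<noteq> 0"
    and a_eq: "\<And>q. q \<in> S \<Longrightarrow> (a q)\<^sup>2 = 1 / sqrt \<bar>(\<mu> q)\<^sup>2 - (\<nu> q)\<^sup>2\<bar>"
  defines "z \<equiv> \<lambda>q. fst (V q)" and "x \<equiv> \<lambda>q. fst (snd (V q))" and "y \<equiv> \<lambda>q. fst (snd (snd (V q)))"
    and "n1 \<equiv> \<lambda>q. fst (snd (snd (snd (V q))))" and "n2 \<equiv> \<lambda>q. snd (snd (snd (snd (V q))))"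
  shows "structure_equations \<epsilon> S a z x y n1 n2 f1 f2 b1 b2 m n \<mu> \<nu>"
proof -
  \<comment> \<open>V is given only as a differentiable solution; the equation itself raises its
    regularity.\<close>
  have sm: "smooth_on S V"
  proof (rule smooth_on_bootstrap [OF bounded_bilinear_framing_action open_S V])
    show "smooth_on S (\<lambda>q. fst h *\<^sub>R coeffs_u q + snd h *\<^sub>R coeffs_v q)" for h
      by (intro smooth_on_add smooth_on_bounded_linear [OF bounded_linear_scaleR_right]
          smooth_on_coeffs open_S)
  qed
  have lin: "bounded_linear (fst :: framing \<Rightarrow> _)" "bounded_linear (\<lambda>V :: framing. fst (snd V))"
    "bounded_linear (\<lambda>V :: framing. fst (snd (snd V)))"
    "bounded_linear (\<lambda>V :: framing. fst (snd (snd (snd V))))"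
    "bounded_linear (\<lambda>V :: framing. snd (snd (snd (snd V))))"
    by (intro bounded_linear_fst bounded_linear_fst_comp bounded_linear_snd_comp bounded_linear_ident)+
  have comp: "smooth_on S z" "smooth_on S x" "smooth_on S y" "smooth_on S n1" "smooth_on S n2"
    unfolding z_def x_def y_def n1_def n2_def
    using lin [THEN smooth_on_bounded_linear, OF open_S sm] by simp_all
  have Vq: "V q = (z q, x q, y q, n1 q, n2 q)" for q
    by (simp add: z_def x_def y_def n1_def n2_def)
  have part: "(partial_u z q, partial_u x q, partial_u y q, partial_u n1 q, partial_u n2 q)
      = framing_action \<epsilon> (coeffs_u q) (V q)"
    "(partial_v z q, partial_v x q, partial_v y q, partial_v n1 q, partial_v n2 q)
      = framing_action \<epsilon> (coeffs_v q) (V q)" if q: "q \<in> S" for q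
    unfolding framing_actionE [OF V [OF q], symmetric] z_def x_def y_def n1_def n2_def
    by (simp_all add: lin [THEN partial_bounded_linear(1), OF sm q]
        lin [THEN partial_bounded_linear(2), OF sm q])
  have frame: "orthonormal_frame \<epsilon> (x q) (y q) (n1 q) (n2 q)" if q: "q \<in> S" for q
  proof -
    have "frame_form \<epsilon> i k (V q) (V q) = frame_form \<epsilon> i k (V c) (V c)" for i k
      by (rule frame_form_constant [OF \<epsilon>_sign \<open>convex S\<close>
            V [where q = p for p] q \<open>c \<in> S\<close>])
    moreover have "x c = x0" "y c = y0" "n1 c = n10" "n2 c = n20"
      using V0 by (simp_all add: x_def y_def n1_def n2_def)
    ultimately show ?thesis
      using assms(3) unfolding orthonormal_frame_iff_columns [OF \<epsilon>_sign] Vq frame_form_def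
      by simp
  qed
  have eqs: "partial_u z q = a q *\<^sub>R x q" "partial_v z q = a q *\<^sub>R y q"
    "partial_u x q = f2 q *\<^sub>R y q + n q *\<^sub>R n1 q" "partial_v x q = f1 q *\<^sub>R y q + m q *\<^sub>R n2 q"
    "partial_u y q = f2 q *\<^sub>R x q + m q *\<^sub>R n2 q" "partial_v y q = f1 q *\<^sub>R x q + n q *\<^sub>R n1 q"
    "partial_u n1 q = - (\<epsilon> * n q) *\<^sub>R x q + b1 q *\<^sub>R n2 q"
    "partial_v n1 q = (\<epsilon> * n q) *\<^sub>R y q + b2 q *\<^sub>R n2 q"
    "partial_u n2 q = - (\<epsilon> * m q) *\<^sub>R y q + b1 q *\<^sub>R n1 q"
    "partial_v n2 q = (\<epsilon> * m q) *\<^sub>R x q + b2 q *\<^sub>R n1 q" if "q \<in> S" for q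
    using part [OF that, unfolded Vq framing_action_def coeffs_u_def coeffs_v_def prod.case prod.inject]
    by simp_all
  show ?thesis
    by unfold_locales (use \<epsilon>_sign nonzero in \<open>simp_all add: eqs comp frame m n a_eq open_S smooth_coeff
        a_positive\<close>)
qed

section \<open>The coefficients determined by the geometric functions\<close>

text \<open>For these coefficients the Codazzi equations are identities, seen by writing
  \<open>L\<close> and \<open>Q\<close> as sum and difference of ln |\<mu> + \<nu>| and ln |\<mu> -
  \<nu>|. The two hyperbolic equations supply Gauss and Ricci.\<close>

lemma frame_coefficients_of_geometric_functions:
  fixes \<mu> \<nu> :: "real \<times> real \<Rightarrow> real"
  assumes \<epsilon>: "\<epsilon> \<in> {1, -1}" and D: "open D" and \<mu>: "smooth_on D \<mu>" and \<nu>: "smooth_on D \<nu>"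
    and ne: "\<And>q. q \<in> D \<Longrightarrow> (\<mu> q)\<^sup>2 - (\<nu> q)\<^sup>2 \<noteq> 0"
    and eq1: "\<And>q. q \<in> D \<Longrightarrow> sqrt \<bar>(\<mu> q)\<^sup>2 - (\<nu> q)\<^sup>2\<bar>
        * hyperbolic_laplacian (\<lambda>r. ln \<bar>(\<mu> r)\<^sup>2 - (\<nu> r)\<^sup>2\<bar>) q = - 4 * \<epsilon> * ((\<mu> q)\<^sup>2 + (\<nu> q)\<^sup>2)"
    and eq2: "\<And>q. q \<in> D \<Longrightarrow> sqrt \<bar>(\<mu> q)\<^sup>2 - (\<nu> q)\<^sup>2\<bar>
        * hyperbolic_laplacian (\<lambda>r. ln \<bar>(\<mu> r + \<nu> r) / (\<mu> r - \<nu> r)\<bar>) q = - 4 * \<epsilon> * \<mu> q * \<nu> q"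
  defines "L \<equiv> \<lambda>r. ln \<bar>(\<mu> r)\<^sup>2 - (\<nu> r)\<^sup>2\<bar>" and "Q \<equiv> \<lambda>r. ln \<bar>(\<mu> r + \<nu> r) / (\<mu> r - \<nu> r)\<bar>"
  defines "a \<equiv> \<lambda>r. exp (- (1/4) * L r)"
  shows "frame_coefficients \<epsilon> D a (\<lambda>r. - (1/4) * partial_u L r) (\<lambda>r. - (1/4) * partial_v L r)
      (\<lambda>r. (1/2) * partial_v Q r) (\<lambda>r. (1/2) * partial_u Q r) (\<lambda>r. a r * \<mu> r) (\<lambda>r. a r * \<nu> r)"
    and "\<And>q. q \<in> D \<Longrightarrow> (a q)\<^sup>2 = 1 / sqrt \<bar>(\<mu> q)\<^sup>2 - (\<nu> q)\<^sup>2\<bar>"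
proof -
  have fact: "(\<mu> q)\<^sup>2 - (\<nu> q)\<^sup>2 = (\<mu> q + \<nu> q) * (\<mu> q - \<nu> q)" for q
    by (simp add: power2_eq_square algebra_simps)
  have ne': "\<mu> q + \<nu> q \<noteq> 0" "\<mu> q - \<nu> q \<noteq> 0" if "q \<in> D" for q
    using ne [OF that] by (auto simp: fact)
  note cmul = smooth_on_bounded_linear [OF bounded_linear_mult_right D]
  define P where "P r = ln \<bar>\<mu> r + \<nu> r\<bar>" for r
  define N where "N r = ln \<bar>\<mu> r - \<nu> r\<bar>" for r
  have sum: "smooth_on D (\<lambda>q. \<mu> q + \<nu> q)" and diff: "smooth_on D (\<lambda>q. \<mu> q - \<nu> q)"
    by (intro smooth_on_add smooth_on_diff D \<mu> \<nu>)+
  have P: "smooth_on D P" and N: "smooth_on D N"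
    unfolding P_def N_def by (intro smooth_on_ln_abs D sum diff ne'; assumption)+
  have LPN: "L q = P q + N q" and QPN: "Q q = P q - N q" if "q \<in> D" for q
    using ne' [OF that]
    by (simp_all add: L_def Q_def P_def N_def fact abs_mult ln_mult abs_divide ln_div)
  have L: "smooth_on D L" and Q: "smooth_on D Q"
    using smooth_on_cong [OF D LPN] smooth_on_cong [OF D QPN]
    by (simp_all only: smooth_on_add [OF D] smooth_on_diff [OF D] P N)
  have a: "smooth_on D a"
    unfolding a_def by (intro smooth_on_exp D cmul L)
  have PN: "partial_u P q = (partial_u \<mu> q + partial_u \<nu> q) / (\<mu> q + \<nu> q)"
    "partial_v P q = (partial_v \<mu> q + partial_v \<nu> q) / (\<mu> q + \<nu> q)"
    "partial_u N q = (partial_u \<mu> q - partial_u \<nu> q) / (\<mu> q - \<nu> q)"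
    "partial_v N q = (partial_v \<mu> q - partial_v \<nu> q) / (\<mu> q - \<nu> q)" if "q \<in> D" for q
    unfolding P_def [abs_def] N_def [abs_def]
    using partial_ln_abs [OF sum that ne'(1) [OF that]] partial_ln_abs [OF diff that ne'(2) [OF that]]
      partial_add [OF \<mu> \<nu> that] partial_diff [OF \<mu> \<nu> that] by simp_all
  have dL: "partial_u L q = partial_u P q + partial_u N q" "partial_v L q = partial_v P q + partial_v N q"
    if "q \<in> D" for q
    using partial_cong [OF D that LPN] partial_add [OF P N that] by simp_all
  have dQ: "partial_u Q q = partial_u P q - partial_u N q" "partial_v Q q = partial_v P q - partial_v N q"
    if "q \<in> D" for q
    using partial_cong [OF D that QPN] partial_diff [OF P N that] by simp_all
  have da: "partial_u a q = a q * (- (1/4) * partial_u L q)" "partial_v a q = a q * (- (1/4) * partial_v L q)"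
    if "q \<in> D" for q
    by (simp_all only: a_def partial_exp [OF cmul [OF L] that]
        partial_bounded_linear [OF bounded_linear_mult_right L that])
  \<comment> \<open>Adding and subtracting the derivatives of \<mu> + \<nu> and \<mu> - \<nu>
    expresses those of \<mu> and \<nu> through \<open>L\<close> and \<open>Q\<close>.\<close>
  have d\<mu>: "partial_u \<mu> q = (\<mu> q * partial_u L q + \<nu> q * partial_u Q q) / 2"
    "partial_v \<mu> q = (\<mu> q * partial_v L q + \<nu> q * partial_v Q q) / 2"
    "partial_u \<nu> q = (\<nu> q * partial_u L q + \<mu> q * partial_u Q q) / 2"
    "partial_v \<nu> q = (\<nu> q * partial_v L q + \<mu> q * partial_v Q q) / 2" if "q \<in> D" for q
  proof -
    have "(\<mu> q + \<nu> q) * partial_u P q = partial_u \<mu> q + partial_u \<nu> q"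
      "(\<mu> q + \<nu> q) * partial_v P q = partial_v \<mu> q + partial_v \<nu> q"
      "(\<mu> q - \<nu> q) * partial_u N q = partial_u \<mu> q - partial_u \<nu> q"
      "(\<mu> q - \<nu> q) * partial_v N q = partial_v \<mu> q - partial_v \<nu> q"
      using ne' [OF that] by (simp_all add: PN that)
    then show "partial_u \<mu> q = (\<mu> q * partial_u L q + \<nu> q * partial_u Q q) / 2"
      "partial_v \<mu> q = (\<mu> q * partial_v L q + \<nu> q * partial_v Q q) / 2"
      "partial_u \<nu> q = (\<nu> q * partial_u L q + \<mu> q * partial_u Q q) / 2"
      "partial_v \<nu> q = (\<nu> q * partial_v L q + \<mu> q * partial_v Q q) / 2"
      unfolding dL [OF that] dQ [OF that] by (simp_all add: algebra_simps)
  qed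
  show a_eq: "(a q)\<^sup>2 = 1 / sqrt \<bar>(\<mu> q)\<^sup>2 - (\<nu> q)\<^sup>2\<bar>" if "q \<in> D" for q
  proof -
    have "(a q)\<^sup>2 = exp (- (L q / 2))"
      by (simp add: a_def power2_eq_square flip: exp_add)
    moreover have "(exp (L q / 2))\<^sup>2 = \<bar>(\<mu> q)\<^sup>2 - (\<nu> q)\<^sup>2\<bar>"
      using ne [OF that] by (simp add: L_def power2_eq_square flip: exp_add)
    then have "exp (L q / 2) = sqrt \<bar>(\<mu> q)\<^sup>2 - (\<nu> q)\<^sup>2\<bar>"
      by (metis exp_ge_zero real_sqrt_unique)
    ultimately show ?thesis by (simp add: exp_minus inverse_eq_divide)
  qed
  \<comment> \<open>By \<open>a_eq\<close>, division by the square root is multiplication by a^2,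
    which is absorbed into a \<mu> and a \<nu>.\<close>
  have lap: "partial_u (partial_u L) q - partial_v (partial_v L) q = - 4 * \<epsilon> * ((a q * \<mu> q)\<^sup>2 + (a q * \<nu> q)\<^sup>2)"
    "partial_u (partial_u Q) q - partial_v (partial_v Q) q = - 4 * \<epsilon> * (a q * \<mu> q) * (a q * \<nu> q)"
    if "q \<in> D" for q
  proof -
    define s where "s = sqrt \<bar>(\<mu> q)\<^sup>2 - (\<nu> q)\<^sup>2\<bar>"
    have "s \<noteq> 0" using ne [OF that] by (simp add: s_def)
    have "hyperbolic_laplacian L q = (a q)\<^sup>2 * (- 4 * \<epsilon> * ((\<mu> q)\<^sup>2 + (\<nu> q)\<^sup>2))"
      "hyperbolic_laplacian Q q = (a q)\<^sup>2 * (- 4 * \<epsilon> * \<mu> q * \<nu> q)"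
      using eq1 [OF that] eq2 [OF that] \<open>s \<noteq> 0\<close>
      unfolding a_eq [OF that] L_def Q_def s_def [symmetric] by (simp_all add: field_simps)
    then show "partial_u (partial_u L) q - partial_v (partial_v L) q
        = - 4 * \<epsilon> * ((a q * \<mu> q)\<^sup>2 + (a q * \<nu> q)\<^sup>2)"
      "partial_u (partial_u Q) q - partial_v (partial_v Q) q = - 4 * \<epsilon> * (a q * \<mu> q) * (a q * \<nu> q)"
      by (simp_all add: hyperbolic_laplacian_def power2_eq_square algebra_simps)
  qed
  note linp = partial_bounded_linear [OF bounded_linear_mult_right]
  show "frame_coefficients \<epsilon> D a (\<lambda>r. - (1/4) * partial_u L r) (\<lambda>r. - (1/4) * partial_v L r)
      (\<lambda>r. (1/2) * partial_v Q r) (\<lambda>r. (1/2) * partial_u Q r) (\<lambda>r. a r * \<mu> r) (\<lambda>r. a r * \<nu> r)"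
  proof
    show "smooth_on D (\<lambda>r. a r * \<mu> r)" "smooth_on D (\<lambda>r. a r * \<nu> r)"
      by (intro smooth_on_mult D a \<mu> \<nu>)+
    show "smooth_on D (\<lambda>r. - (1/4) * partial_u L r)" "smooth_on D (\<lambda>r. - (1/4) * partial_v L r)"
      "smooth_on D (\<lambda>r. (1/2) * partial_v Q r)" "smooth_on D (\<lambda>r. (1/2) * partial_u Q r)"
      by (intro cmul smooth_on_partial L Q)+
    fix q assume q: "q \<in> D"
    note mult = partial_bounded_bilinear [OF bounded_bilinear_mult a _ q]
    show "partial_u (\<lambda>r. a r * \<mu> r) q
        = (1/2) * partial_u Q q * (a q * \<nu> q) - (- (1/4) * partial_u L q) * (a q * \<mu> q)"
      "partial_v (\<lambda>r. a r * \<mu> r) q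
        = (1/2) * partial_v Q q * (a q * \<nu> q) - (- (1/4) * partial_v L q) * (a q * \<mu> q)"
      "partial_u (\<lambda>r. a r * \<nu> r) q
        = (1/2) * partial_u Q q * (a q * \<mu> q) - (- (1/4) * partial_u L q) * (a q * \<nu> q)"
      "partial_v (\<lambda>r. a r * \<nu> r) q
        = (1/2) * partial_v Q q * (a q * \<mu> q) - (- (1/4) * partial_v L q) * (a q * \<nu> q)"
      by (simp_all only: mult \<mu> \<nu> da d\<mu> q) (simp_all add: field_simps)
    show "partial_u (\<lambda>r. - (1/4) * partial_u L r) q - partial_v (\<lambda>r. - (1/4) * partial_v L r) q
        = \<epsilon> * ((a q * \<mu> q)\<^sup>2 + (a q * \<nu> q)\<^sup>2)"
      unfolding linp(1) [OF smooth_on_partial(1) [OF L] q] linp(2) [OF smooth_on_partial(2) [OF L] q]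
      using lap(1) [OF q] by linarith
    show "partial_u (\<lambda>r. (1/2) * partial_u Q r) q - partial_v (\<lambda>r. (1/2) * partial_v Q r) q
        = - 2 * \<epsilon> * (a q * \<mu> q) * (a q * \<nu> q)"
      unfolding linp(1) [OF smooth_on_partial(1) [OF Q] q] linp(2) [OF smooth_on_partial(2) [OF Q] q]
      using lap(2) [OF q] by linarith
  qed (use \<epsilon> D a da in \<open>simp_all add: a_def\<close>)
qed


section \<open>Existence and uniqueness\<close>

theorem theorem4p2:
  fixes \<epsilon> :: real
    and \<mu> \<nu> :: "real \<times> real \<Rightarrow> real"
    and D :: "(real \<times> real) set"
    and c :: "real \<times> real"
    and p0 x0 y0 n10 n20 :: "real^4"
  assumes "\<epsilon> \<in> {1, -1}"
    and "open D" and "connected D"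
    and "smooth_on D \<mu>" and "smooth_on D \<nu>"
    and "\<And>q. q \<in> D \<Longrightarrow> \<mu> q * \<nu> q \<noteq> 0"
    and "\<And>q. q \<in> D \<Longrightarrow> (\<mu> q)\<^sup>2 - (\<nu> q)\<^sup>2 \<noteq> 0"
    and "\<And>q. q \<in> D \<Longrightarrow>
           sqrt \<bar>(\<mu> q)\<^sup>2 - (\<nu> q)\<^sup>2\<bar>
             * hyperbolic_laplacian (\<lambda>r. ln \<bar>(\<mu> r)\<^sup>2 - (\<nu> r)\<^sup>2\<bar>) q
           = - 4 * \<epsilon> * ((\<mu> q)\<^sup>2 + (\<nu> q)\<^sup>2)"
    and "\<And>q. q \<in> D \<Longrightarrow>
           sqrt \<bar>(\<mu> q)\<^sup>2 - (\<nu> q)\<^sup>2\<bar>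
             * hyperbolic_laplacian (\<lambda>r. ln \<bar>(\<mu> r + \<nu> r) / (\<mu> r - \<nu> r)\<bar>) q
           = - 4 * \<epsilon> * \<mu> q * \<nu> q"
    and "c \<in> D"
    and "orthonormal_frame \<epsilon> x0 y0 n10 n20"
  shows "\<exists>D0. open D0 \<and> connected D0 \<and> D0 \<subseteq> D \<and> c \<in> D0 \<and>
           (\<exists>z. canonical_realization \<epsilon> \<mu> \<nu> c p0 x0 y0 n10 n20 D0 z \<and>
              (\<forall>z'. canonical_realization \<epsilon> \<mu> \<nu> c p0 x0 y0 n10 n20 D0 z' \<longrightarrow>
                 (\<forall>q\<in>D0. z' q = z q)))"
proof -
  define L where "L r = ln \<bar>(\<mu> r)\<^sup>2 - (\<nu> r)\<^sup>2\<bar>" for r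
  define Q where "Q r = ln \<bar>(\<mu> r + \<nu> r) / (\<mu> r - \<nu> r)\<bar>" for r
  define a where "a r = exp (- (1/4) * L r)" for r
  define f1 where "f1 r = - (1/4) * partial_u L r" for r
  define f2 where "f2 r = - (1/4) * partial_v L r" for r
  define b1 where "b1 r = (1/2) * partial_v Q r" for r
  define b2 where "b2 r = (1/2) * partial_u Q r" for r
  define m where "m r = a r * \<mu> r" for r
  define n where "n r = a r * \<nu> r" for r
  note coeff = frame_coefficients_of_geometric_functions [OF assms(1,2,4,5,7,8,9),
      folded L_def Q_def, folded a_def, folded f1_def f2_def b1_def b2_def m_def n_def]
  interpret D: frame_coefficients \<epsilon> D a f1 f2 b1 b2 m n
    by (rule coeff(1))
  have a_eq: "(a q)\<^sup>2 = 1 / sqrt \<bar>(\<mu> q)\<^sup>2 - (\<nu> q)\<^sup>2\<bar>" if "q \<in> D" for q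
    using coeff(2) that by blast
  let ?solves = "\<lambda>S V. \<forall>p\<in>S. (V has_derivative
      (\<lambda>h. framing_action \<epsilon> (fst h *\<^sub>R D.coeffs_u p + snd h *\<^sub>R D.coeffs_v p) (V p))) (at p)"
  \<comment> \<open>One ball serves both existence and uniqueness, since a competing surface is
    defined on exactly this domain.\<close>
  obtain r V where r: "r > 0" "ball c r \<subseteq> D"
    and V0: "V c = (p0, x0, y0, n10, n20)" and V: "?solves (ball c r) V"
    and unique: "\<And>V W p. V c = W c \<Longrightarrow> ?solves (ball c r) V \<Longrightarrow> ?solves (ball c r) W \<Longrightarrow>
      p \<in> ball c r \<Longrightarrow> V p = W p"
    using flat_total_equation_local [OF bounded_bilinear_framing_action assms(2,10) D.smooth_on_coeffs
        D.coeffs_flat, of "(p0, x0, y0, n10, n20)"]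
    by blast
  define S where "S = ball c r"
  have S: "open S" "connected S" "convex S" "S \<subseteq> D" "c \<in> S"
    using r by (auto simp: S_def convex_connected)
  interpret S: frame_coefficients \<epsilon> S a f1 f2 b1 b2 m n
    by (rule D.frame_coefficients_subset [OF S(1,4)])
  have mn: "m q = a q * \<mu> q" "n q = a q * \<nu> q" for q
    by (simp_all add: m_def n_def)
  have ne: "\<mu> q * \<nu> q \<noteq> 0" "(\<mu> q)\<^sup>2 - (\<nu> q)\<^sup>2 \<noteq> 0" "(a q)\<^sup>2 = 1 / sqrt \<bar>(\<mu> q)\<^sup>2 - (\<nu> q)\<^sup>2\<bar>"
    if "q \<in> S" for q
    using that S assms(6,7) a_eq by blast+
  have V': "(V has_derivative
      (\<lambda>h. framing_action \<epsilon> (fst h *\<^sub>R D.coeffs_u q + snd h *\<^sub>R D.coeffs_v q) (V q))) (at q)"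
    if "q \<in> S" for q
    using V that by (simp add: S_def)
  let ?z = "\<lambda>q. fst (V q)" and ?x = "\<lambda>q. fst (snd (V q))" and ?y = "\<lambda>q. fst (snd (snd (V q)))"
  let ?n1 = "\<lambda>q. fst (snd (snd (snd (V q))))" and ?n2 = "\<lambda>q. snd (snd (snd (snd (V q))))"
  interpret E: structure_equations \<epsilon> S a ?z ?x ?y ?n1 ?n2 f1 f2 b1 b2 m n \<mu> \<nu>
    by (rule S.structure_equations_of_solution [OF S(3,5) assms(11) V' V0 mn ne])
  have "canonical_realization \<epsilon> \<mu> \<nu> c p0 x0 y0 n10 n20 S ?z"
    unfolding canonical_realization_def
    by (intro conjI exI [of _ ?x] exI [of _ ?y] exI [of _ ?n1] exI [of _ ?n2]
        E.general_type E.geometric E.canonical) (simp_all add: V0)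
  moreover have "z' q = ?z q"
    if z': "canonical_realization \<epsilon> \<mu> \<nu> c p0 x0 y0 n10 n20 S z'" and q: "q \<in> S" for z' q
  proof -
    obtain x y n1 n2 where geo: "geometric_frame_field z' S \<epsilon> \<mu> \<nu> x y n1 n2"
      and c: "z' c = p0" "x c = x0" "y c = y0" "n1 c = n10" "n2 c = n20"
      and can: "canonical_parameters z' S \<mu> \<nu> x y"
      using z' unfolding canonical_realization_def by blast
    have ad': "smooth_on S x" "smooth_on S y" "smooth_on S n1" "smooth_on S n2"
      "\<And>q. q \<in> S \<Longrightarrow> orthonormal_frame \<epsilon> (x q) (y q) (n1 q) (n2 q)"
      using geo by (simp_all add: geometric_frame_field_def adapted_frame_on_def)
    have sm: "smooth_on S z'"
      using z' by (simp add: canonical_realization_def minimal_general_type_def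
          minimal_lorentz_surface_def lorentz_surface_def)
    \<comment> \<open>Canonical parameters force E = a^2, and a > 0 selects the root; the conformal
      factor of the competing surface is thereby fixed by \<mu> and \<nu>.\<close>
    have p: "partial_u z' q = a q *\<^sub>R x q" "partial_v z' q = a q *\<^sub>R y q" if "q \<in> S" for q
      using can that S.a_positive [OF that] ne(3) [OF that, symmetric]
      by (simp_all add: canonical_parameters_def)
    interpret z': geometric_coefficients \<epsilon> S a z' x y n1 n2 f1 f2 b1 b2 m n \<mu> \<nu>
      by unfold_locales
        (rule assms(1) S(1) ad' sm p mn ne S.a_positive S.smooth_coeff; assumption)+
    interpret z': structure_equations \<epsilon> S a z' x y n1 n2 f1 f2 b1 b2 m n \<mu> \<nu>
      using geo by (intro z'.structure_equationsI) (simp_all add: geometric_frame_field_def)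
    \<comment> \<open>Whole framings are compared: point and frame agree at c, so they agree
      throughout the ball, and the first component is the surface.\<close>
    have "(\<lambda>q. (z' q, x q, y q, n1 q, n2 q)) q = V q"
    proof (rule unique)
      show "?solves (ball c r) (\<lambda>q. (z' q, x q, y q, n1 q, n2 q))"
        using z'.framing_solves by (simp add: S_def)
    qed (use V V0 c q in \<open>simp_all add: S_def\<close>)
    then show ?thesis by (metis fst_conv)
  qed
  ultimately show ?thesis
    using S by blast
qed

end
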